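(* Let $K\subset\mathbb{E}$ be a symmetric cone with a $\nu$-self-scaled barrier $F$ such that for all $x\in\operatorname{int}K$, $h_x\in\mathbb{E}$ and $\alpha,\beta\in\mathbb{R}$, $$D^4F(x)[h_x][\alpha x+\beta h_x]^2\;\preceq_{K^*}\;-3\,D^3F(x)[\alpha x+\beta h_x]^2\cdot\|h_x\|_x .$$ Then the function $$\Phi(x,s,v)=F\big(x+v^2\nabla F_*(s)\big)+F_*(s)$$ is a self-concordant barrier for the cone $\mathcal{C}(K)$ (the hyperbolic coupling of $K\times K^*$) with parameter $2\nu$.
   Context: $\mathbb{E}$ is a finite-dimensional real vector space, $\mathbb{E}^*$ its dual, $\langle s,x\rangle$ the value of $s\in\mathbb{E}^*$ at $x\in\mathbb{E}$. $\nabla f(x)\in\mathbb{E}^*$ and $\nabla^2f(x):\mathbb{E}\to\mathbb{E}^*$ denote gradient and Hessian. $D^3F(x)[q]^2\in\mathbb{E}^*$ is the functional $p\mapsto D^3F(x)[q,q,p]$, and $D^4F(x)[h][q]^2\in\mathbb{E}^*$ is the functional $p\mapsto D^4F(x)[h,q,q,p]$ (barriers are assumed sufficiently smooth). $\|h\|_x=\langle\nabla^2F(x)h,h\rangle^{1/2}$. For $a,b\in\mathbb{E}^*$, $a\preceq_{K^*}b$ means $b-a\in K^*$. A closed convex function $f$, $C^3$ on its open domain, is self-concordant if $D^3f(x)[h]^3\le2(D^2f(x)[h]^2)^{3/2}$ for all $x\in\operatorname{dom}f$ and all $h$. It is a self-concordant barrier with parameter $\nu\ge1$ if in addition $\langle\nabla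 f(x),h\rangle^2\le\nu\langle\nabla^2f(x)h,h\rangle$ for all $x\in\operatorname{dom}f$ and all $h$; it is a barrier for a cone if its domain is the interior of the cone. A proper cone $K$ is a closed convex cone containing no straight line (with nonempty interior); $K^*=\{s\in\mathbb{E}^*:\langle s,x\rangle\ge0\ \forall x\in K\}$. A $\nu$-normal (regular) barrier for $K$ is a self-concordant barrier $F$ for $K$ with parameter $\nu$ and $F(\tau x)=F(x)-\nu\ln\tau$ for $x\in\operatorname{int}K$, $\tau>0$. Its dual barrier is $F_*(s)=\max_{x\in\operatorname{int}K}[-\langle s,x\rangle-F(x)]$, $s\in\operatorname{int}K^*$. $F$ is a $\nu$-self-scaled barrier for $K$ if it is a $\nu$-normal barrier and for all $x,w\in\operatorname{int}K$: $\nabla^2F(w)x\in\operatorname{int}K^*$ and $F_*(\nabla^2F(w)x)=F(x)-2F(w)-\nu$. A cone is symmetric iff it admits a self-scaled barrier. The hyperbolic coupling is $\mathcal{C}(K)=\{(x,s,v)\in K\times K^*\times\mathbb{R}:\ x+v^2\nabla F_*(s)\in K\}$. Its interior, on which $\Phi$ is considered, is $\{(x,s,v)\in\operatorname{int}K\times\operatorname{int}K^*\times\mathbb{R}:\ x+v^2\nabla F_*(s)\in\operatorname{int}K\}$. *)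

theory Defs
  imports "HOL-Analysis.Analysis"
begin

section \<open>Derivatives\<close>

text \<open>
  The dual of \<^typ>\<open>'a\<close> is the type \<^typ>\<open>'a \<Rightarrow>\<^sub>L real\<close>. With \<open>fderiv\<close> the gradient of a real
  function at a point lies in the dual, its Hessian maps the space to the dual, and
  \<open>D4 f x h q q\<close> is the functional \<open>p \<mapsto> D\<^sup>4f(x)[h,q,q,p]\<close>. The values are meaningful only where
  \<open>f\<close> is differentiable sufficiently often.
\<close>

definition fderiv ::
    "('a::real_normed_vector \<Rightarrow> 'b::real_normed_vector) \<Rightarrow> 'a \<Rightarrow> 'a \<Rightarrow>\<^sub>L 'b"
  where "fderiv f x = Blinfun (frechet_derivative f (at x))"

abbreviation grad :: "('a::real_normed_vector \<Rightarrow> real) \<Rightarrow> 'a \<Rightarrow> 'a \<Rightarrow>\<^sub>L real"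
  where "grad f \<equiv> fderiv f"

abbreviation hess :: "('a::real_normed_vector \<Rightarrow> real) \<Rightarrow> 'a \<Rightarrow> 'a \<Rightarrow>\<^sub>L 'a \<Rightarrow>\<^sub>L real"
  where "hess f \<equiv> fderiv (grad f)"

abbreviation D3 :: "('a::real_normed_vector \<Rightarrow> real) \<Rightarrow> 'a \<Rightarrow> 'a \<Rightarrow>\<^sub>L 'a \<Rightarrow>\<^sub>L 'a \<Rightarrow>\<^sub>L real"
  where "D3 f \<equiv> fderiv (hess f)"

abbreviation D4 ::
    "('a::real_normed_vector \<Rightarrow> real) \<Rightarrow> 'a \<Rightarrow> 'a \<Rightarrow>\<^sub>L 'a \<Rightarrow>\<^sub>L 'a \<Rightarrow>\<^sub>L 'a \<Rightarrow>\<^sub>L real"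
  where "D4 f \<equiv> fderiv (D3 f)"

lemma fderiv_eqI:
  assumes "(f has_derivative blinfun_apply f') (at x)"
  shows "fderiv f x = f'"
  using frechet_derivative_at[OF assms] by (metis fderiv_def blinfun_apply_inverse)

text \<open>The classes \<open>C\<^sup>3\<close> and \<open>C\<^sup>4\<close>; they are used for open \<open>S\<close> only.\<close>

definition C3_on :: "'a::real_normed_vector set \<Rightarrow> ('a \<Rightarrow> real) \<Rightarrow> bool"
  where "C3_on S f \<longleftrightarrow>
    f differentiable_on S \<and> grad f differentiable_on S \<and> hess f differentiable_on S \<and>
    continuous_on S (D3 f)"

definition C4_on :: "'a::real_normed_vector set \<Rightarrow> ('a \<Rightarrow> real) \<Rightarrow> bool"
  where "C4_on S f \<longleftrightarrow>
    f differentiable_on S \<and> grad f differentiable_on S \<and> hess f differentiable_on S \<and>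
    D3 f differentiable_on S \<and> continuous_on S (D4 f)"

definition local_norm :: "('a::real_normed_vector \<Rightarrow> real) \<Rightarrow> 'a \<Rightarrow> 'a \<Rightarrow> real"
  where "local_norm f x h = sqrt (hess f x h h)"

section \<open>Self-concordant barriers\<close>

text \<open>
  An extended-valued function with open domain \<open>S\<close> is represented by \<open>S\<close> together with a real
  function whose values outside \<open>S\<close> are irrelevant. Closedness of the extended-valued function is
  closedness of its epigraph.
\<close>

definition self_concordant :: "'a::real_normed_vector set \<Rightarrow> ('a \<Rightarrow> real) \<Rightarrow> bool"
  where "self_concordant S f \<longleftrightarrow>
    open S \<and> convex_on S f \<and> closed (epigraph S f) \<and> C3_on S f \<and>
    (\<forall>x\<in>S. \<forall>h. D3 f x h h h \<le> 2 * (hess f x h h) powr (3/2))"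

definition self_concordant_barrier ::
    "'a::real_normed_vector set \<Rightarrow> ('a \<Rightarrow> real) \<Rightarrow> real \<Rightarrow> bool"
  where "self_concordant_barrier S f \<nu> \<longleftrightarrow>
    self_concordant S f \<and> \<nu> \<ge> 1 \<and> (\<forall>x\<in>S. \<forall>h. (grad f x h)\<^sup>2 \<le> \<nu> * hess f x h h)"

definition self_concordant_barrier_for ::
    "'a::real_normed_vector set \<Rightarrow> ('a \<Rightarrow> real) \<Rightarrow> real \<Rightarrow> bool"
  where "self_concordant_barrier_for K f \<nu> \<longleftrightarrow> self_concordant_barrier (interior K) f \<nu>"

section \<open>Cones, dual barriers and self-scaled barriers\<close>

definition proper_cone :: "'a::real_normed_vector set \<Rightarrow> bool"
  where "proper_cone K \<longleftrightarrow>
    closed K \<and> convex_cone K \<and> interior K \<noteq> {} \<and>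
    \<not> (\<exists>x d. d \<noteq> 0 \<and> (\<forall>t::real. x + t *\<^sub>R d \<in> K))"

definition dual_cone :: "'a::real_normed_vector set \<Rightarrow> ('a \<Rightarrow>\<^sub>L real) set"
  where "dual_cone K = {s. \<forall>x\<in>K. blinfun_apply s x \<ge> 0}"

definition dual_cone_le ::
    "'a::real_normed_vector set \<Rightarrow> ('a \<Rightarrow>\<^sub>L real) \<Rightarrow> ('a \<Rightarrow>\<^sub>L real) \<Rightarrow> bool"
  where "dual_cone_le K a b \<longleftrightarrow> b - a \<in> dual_cone K"

text \<open>
  For a normal barrier of a proper cone and \<open>s\<close> in the interior of the dual cone the supremum below
  is a maximum; elsewhere the value is not used.
\<close>

definition dual_barrier ::
    "'a::real_normed_vector set \<Rightarrow> ('a \<Rightarrow> real) \<Rightarrow> ('a \<Rightarrow>\<^sub>L real) \<Rightarrow> real"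
  where "dual_barrier K F s = (SUP x\<in>interior K. - blinfun_apply s x - F x)"

definition normal_barrier ::
    "'a::real_normed_vector set \<Rightarrow> real \<Rightarrow> ('a \<Rightarrow> real) \<Rightarrow> bool"
  where "normal_barrier K \<nu> F \<longleftrightarrow>
    self_concordant_barrier_for K F \<nu> \<and>
    (\<forall>x\<in>interior K. \<forall>\<tau>>0. F (\<tau> *\<^sub>R x) = F x - \<nu> * ln \<tau>)"

definition self_scaled_barrier ::
    "'a::real_normed_vector set \<Rightarrow> real \<Rightarrow> ('a \<Rightarrow> real) \<Rightarrow> bool"
  where "self_scaled_barrier K \<nu> F \<longleftrightarrow>
    normal_barrier K \<nu> F \<and>
    (\<forall>x\<in>interior K. \<forall>w\<in>interior K.
      blinfun_apply (hess F w) x \<in> interior (dual_cone K) \<and>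
      dual_barrier K F (blinfun_apply (hess F w) x) = F x - 2 * F w - \<nu>)"

definition symmetric_cone :: "'a::real_normed_vector set \<Rightarrow> bool"
  where "symmetric_cone K \<longleftrightarrow> proper_cone K \<and> (\<exists>\<nu> F. self_scaled_barrier K \<nu> F)"

section \<open>The hyperbolic coupling\<close>

text \<open>
  The gradient of a function on the dual is an element of the bidual, which is identified with the
  space itself: \<open>dual_grad G s\<close> is the vector \<open>x\<close> with \<open>DG(s)[t] = \<langle>t,x\<rangle>\<close> for all \<open>t\<close>.
\<close>

definition dual_grad ::
    "(('a::euclidean_space \<Rightarrow>\<^sub>L real) \<Rightarrow> real) \<Rightarrow> ('a \<Rightarrow>\<^sub>L real) \<Rightarrow> 'a"
  where "dual_grad G s = (THE x. \<forall>t. blinfun_apply (grad G s) t = blinfun_apply t x)"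

lemma bidual_representation:
  fixes \<phi> :: "('a::euclidean_space \<Rightarrow>\<^sub>L real) \<Rightarrow>\<^sub>L real"
  shows "\<exists>!x. \<forall>t. blinfun_apply \<phi> t = blinfun_apply t x"
proof (rule ex_ex1I)
  let ?x = "\<Sum>b\<in>Basis. blinfun_apply \<phi> (blinfun_inner_left b) *\<^sub>R b"
  have "blinfun_apply \<phi> t = blinfun_apply t ?x" for t
  proof -
    have "t = (\<Sum>b\<in>Basis. blinfun_apply t b *\<^sub>R blinfun_inner_left b)"
    proof (rule blinfun_eqI)
      fix y
      have "blinfun_apply t y = blinfun_apply t (\<Sum>b\<in>Basis. (y \<bullet> b) *\<^sub>R b)"
        by (simp add: euclidean_representation)
      also have "\<dots> = (\<Sum>b\<in>Basis. (y \<bullet> b) * blinfun_apply t b)"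
        by (simp add: blinfun.sum_right blinfun.scaleR_right)
      also have "\<dots> = blinfun_apply (\<Sum>b\<in>Basis. blinfun_apply t b *\<^sub>R blinfun_inner_left b) y"
        by (simp add: blinfun.sum_left blinfun.scaleR_left mult.commute)
      finally show "blinfun_apply t y =
          blinfun_apply (\<Sum>b\<in>Basis. blinfun_apply t b *\<^sub>R blinfun_inner_left b) y" .
    qed
    then have "blinfun_apply \<phi> t =
        blinfun_apply \<phi> (\<Sum>b\<in>Basis. blinfun_apply t b *\<^sub>R blinfun_inner_left b)"
      by (rule arg_cong)
    then show ?thesis
      by (simp add: blinfun.sum_right blinfun.scaleR_right mult.commute)
  qed
  then show "\<exists>x. \<forall>t. blinfun_apply \<phi> t = blinfun_apply t x" by blast
next
  fix x y :: 'a
  assume x: "\<forall>t. blinfun_apply \<phi> t = blinfun_apply t x"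
    and y: "\<forall>t. blinfun_apply \<phi> t = blinfun_apply t y"
  have "x \<bullet> b = y \<bullet> b" for b
    using x[rule_format, of "blinfun_inner_left b"] y[rule_format, of "blinfun_inner_left b"]
    by simp
  then show "x = y" by (rule euclidean_eqI)
qed

lemma dual_grad_apply: "blinfun_apply t (dual_grad G s) = blinfun_apply (grad G s) t"
  unfolding dual_grad_def
  by (rule theI'[OF bidual_representation[of "grad G s"], rule_format, symmetric])

text \<open>
  At boundary points \<open>s\<close> of the dual cone \<open>dual_barrier K F\<close> has no gradient and membership in
  the set below is an artefact of totality. The interior of the set, which is all that
  \<open>self_concordant_barrier_for\<close> uses, is not affected: there \<open>s\<close> is in the interior of the dual
  cone.
\<close>

definition hyperbolic_coupling ::
    "'a::euclidean_space set \<Rightarrow> ('a \<Rightarrow> real) \<Rightarrow> ('a \<times> ('a \<Rightarrow>\<^sub>L real) \<times> real) set"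
  where "hyperbolic_coupling K F =
    {(x, s, v). x \<in> K \<and> s \<in> dual_cone K \<and> x + v\<^sup>2 *\<^sub>R dual_grad (dual_barrier K F) s \<in> K}"

lemma interior_hyperbolic_coupling_subset:
  "interior (hyperbolic_coupling K F) \<subseteq> interior K \<times> interior (dual_cone K) \<times> UNIV"
proof -
  have "hyperbolic_coupling K F \<subseteq> K \<times> dual_cone K \<times> UNIV"
    by (auto simp: hyperbolic_coupling_def)
  from interior_mono[OF this] show ?thesis
    by (simp add: interior_Times)
qed

definition coupling_barrier ::
    "'a::euclidean_space set \<Rightarrow> ('a \<Rightarrow> real) \<Rightarrow> 'a \<times> ('a \<Rightarrow>\<^sub>L real) \<times> real \<Rightarrow> real"
  where "coupling_barrier K F = (\<lambda>(x, s, v).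
    F (x + v\<^sup>2 *\<^sub>R dual_grad (dual_barrier K F) s) + dual_barrier K F s)"

end

theory Submission
  imports Defs
begin

text \<open>
  Fix \<open>w \<in> int K\<close> and put \<open>A = \<nabla>\<^sup>2F(w)\<close>. The self-scaling identity says \<open>F\<^sub>* \<circ> A = F + const\<close>, and
  \<open>A\<close> maps \<open>int K\<close> onto \<open>int K\<^sup>*\<close>. So with \<open>z = A\<^sup>-\<^sup>1s\<close> the function becomes, up to a constant,
  \<open>F(y) + F(z)\<close> with \<open>y = x + v\<^sup>2 A\<^sup>-\<^sup>1\<nabla>F(z)\<close>, and every property of \<open>F\<^sub>*\<close> is one of \<open>F\<close>.

  Along the direction \<open>(h, A\<zeta>, r)\<close> homogeneity of \<open>F\<close> gives \<open>y'' = A\<^sup>-\<^sup>1 D\<^sup>3F(z)[q]\<^sup>2\<close> and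
  \<open>y''' = A\<^sup>-\<^sup>1 D\<^sup>4F(z)[\<zeta>][q]\<^sup>2\<close> with \<open>q = v\<zeta> - rz\<close>. The hypothesis therefore gives \<open>-y'' \<in> K\<close> and
  \<open>y''' - 3 \<parallel>\<zeta>\<parallel>\<^sub>z y'' \<in> K\<close>, that is, \<open>y\<close> is compatible with the barrier \<open>F(z)\<close> in the sense of
  Nesterov and Nemirovskii. Since \<open>\<parallel>k\<parallel>\<^sub>y \<le> -\<langle>\<nabla>F(y), k\<rangle>\<close> for \<open>k \<in> K\<close>, the third derivative of
  \<open>F(y) + F(z)\<close> is at most \<open>2P\<^sup>3 + 3PQ + 3RQ + 2R\<^sup>3\<close>, where \<open>P = \<parallel>y'\<parallel>\<^sub>y\<close>,
  \<open>Q = \<langle>\<nabla>F(y), y''\<rangle>\<close>, \<open>R = \<parallel>\<zeta>\<parallel>\<^sub>z\<close>, and the second derivative is \<open>P\<^sup>2 + Q + R\<^sup>2\<close>.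
\<close>

section \<open>Maps of class \<open>C\<^sup>1\<close>, \<open>C\<^sup>2\<close> and \<open>C\<^sup>3\<close>\<close>

lemma fderiv_works:
  "f differentiable (at x) \<Longrightarrow> (f has_derivative blinfun_apply (fderiv f x)) (at x)"
  by (metis fderiv_def bounded_linear_Blinfun_apply frechet_derivative_works
      has_derivative_bounded_linear)

text \<open>The derivative has a new type at each order, so the order cannot be the argument of one
  recursive definition. Each class refers to the one below through \<open>fderiv\<close>, and
  closure rules descend one order at a time.\<close>

definition C1_map :: "'a::real_normed_vector set \<Rightarrow> ('a \<Rightarrow> 'b::real_normed_vector) \<Rightarrow> bool"
  where "C1_map S f \<longleftrightarrow> f differentiable_on S \<and> continuous_on S (fderiv f)"

definition C2_map :: "'a::real_normed_vector set \<Rightarrow> ('a \<Rightarrow> 'b::real_normed_vector) \<Rightarrow> bool"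
  where "C2_map S f \<longleftrightarrow> f differentiable_on S \<and> C1_map S (fderiv f)"

definition C3_map :: "'a::real_normed_vector set \<Rightarrow> ('a \<Rightarrow> 'b::real_normed_vector) \<Rightarrow> bool"
  where "C3_map S f \<longleftrightarrow> f differentiable_on S \<and> C2_map S (fderiv f)"

lemma C3_on_iff_C3_map: "C3_on S f \<longleftrightarrow> C3_map S f"
  by (simp add: C3_on_def C3_map_def C2_map_def C1_map_def)

lemma C4_on_iff_C3_map: "C4_on S f \<longleftrightarrow> f differentiable_on S \<and> C3_map S (grad f)"
  by (simp add: C4_on_def C3_map_def C2_map_def C1_map_def)

lemma C1_map_continuous: "C1_map S f \<Longrightarrow> continuous_on S f"
  by (simp add: C1_map_def differentiable_imp_continuous_on)

lemma C2_map_imp_C1_map: "C2_map S f \<Longrightarrow> C1_map S f"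
  by (simp add: C2_map_def C1_map_continuous C1_map_def)

lemma C3_map_imp_C2_map: "C3_map S f \<Longrightarrow> C2_map S f"
  by (simp add: C3_map_def C2_map_def C2_map_imp_C1_map[unfolded C2_map_def])

lemma C1_map_has_derivative:
  "C1_map S f \<Longrightarrow> open S \<Longrightarrow> x \<in> S \<Longrightarrow> (f has_derivative blinfun_apply (fderiv f x)) (at x)"
  by (metis C1_map_def differentiable_on_eq_differentiable_at fderiv_works)

lemma C1_mapI:
  assumes S: "open S"
    and f: "\<And>x. x \<in> S \<Longrightarrow> (f has_derivative blinfun_apply (f' x)) (at x)"
    and f': "continuous_on S f'"
  shows "C1_map S f"
proof -
  have "fderiv f x = f' x" if "x \<in> S" for x
    using f[OF that] by (rule fderiv_eqI)
  then have "continuous_on S (fderiv f)"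
    using f' by (simp cong: continuous_on_cong)
  moreover have "f differentiable_on S"
    using f by (auto simp: differentiable_on_def differentiable_def intro: has_derivative_at_withinI)
  ultimately show ?thesis by (simp add: C1_map_def)
qed

text \<open>Agreement on an open set fixes the derivative there. This lets \<open>fderiv f\<close>
  be exchanged for an explicit formula that agrees with it only on \<open>S\<close>.\<close>

lemma C1_map_cong:
  assumes S: "open S" and f: "C1_map S f" and eq: "\<And>x. x \<in> S \<Longrightarrow> g x = f x"
  shows "C1_map S g"
proof (rule C1_mapI[OF S, where f' = "fderiv f"])
  fix x assume "x \<in> S"
  then show "(g has_derivative blinfun_apply (fderiv f x)) (at x)"
    using has_derivative_transform_within_open[OF C1_map_has_derivative[OF f S] S] eq by metis
qed (use f in \<open>simp add: C1_map_def\<close>)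

lemma C2_mapI:
  assumes S: "open S"
    and f: "\<And>x. x \<in> S \<Longrightarrow> (f has_derivative blinfun_apply (f' x)) (at x)"
    and f': "C1_map S f'"
  shows "C2_map S f"
  using C1_mapI[OF S f C1_map_continuous[OF f']] C1_map_cong[OF S f', of "fderiv f"] f
  by (simp add: C2_map_def C1_map_def fderiv_eqI)

lemma C2_map_cong:
  assumes S: "open S" and f: "C2_map S f" and eq: "\<And>x. x \<in> S \<Longrightarrow> g x = f x"
  shows "C2_map S g"
proof (rule C2_mapI[OF S, where f' = "fderiv f"])
  fix x assume "x \<in> S"
  then show "(g has_derivative blinfun_apply (fderiv f x)) (at x)"
    using has_derivative_transform_within_open
        [OF C1_map_has_derivative[OF C2_map_imp_C1_map[OF f] S] S] eq by metis
qed (use f in \<open>simp add: C2_map_def\<close>)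

lemma C3_mapI:
  assumes S: "open S"
    and f: "\<And>x. x \<in> S \<Longrightarrow> (f has_derivative blinfun_apply (f' x)) (at x)"
    and f': "C2_map S f'"
  shows "C3_map S f"
  using C2_mapI[OF S f C2_map_imp_C1_map[OF f']] C2_map_cong[OF S f', of "fderiv f"] f
  by (simp add: C3_map_def C2_map_def fderiv_eqI)

lemma C3_map_cong:
  assumes S: "open S" and f: "C3_map S f" and eq: "\<And>x. x \<in> S \<Longrightarrow> g x = f x"
  shows "C3_map S g"
proof (rule C3_mapI[OF S, where f' = "fderiv f"])
  fix x assume "x \<in> S"
  then show "(g has_derivative blinfun_apply (fderiv f x)) (at x)"
    using has_derivative_transform_within_open
        [OF C1_map_has_derivative[OF C2_map_imp_C1_map[OF C3_map_imp_C2_map[OF f]] S] S] eq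
    by metis
qed (use f in \<open>simp add: C3_map_def\<close>)

lemma C1_map_const: "open S \<Longrightarrow> C1_map S (\<lambda>x. c)"
  by (rule C1_mapI[where f' = "\<lambda>x. 0"]) (auto intro!: derivative_eq_intros)

lemma C2_map_const: "open S \<Longrightarrow> C2_map S (\<lambda>x. c)"
  by (rule C2_mapI[where f' = "\<lambda>x. 0"]) (auto intro!: derivative_eq_intros C1_map_const)

lemma C3_map_const: "open S \<Longrightarrow> C3_map S (\<lambda>x. c)"
  by (rule C3_mapI[where f' = "\<lambda>x. 0"]) (auto intro!: derivative_eq_intros C2_map_const)

lemma C1_map_add: "open S \<Longrightarrow> C1_map S f \<Longrightarrow> C1_map S g \<Longrightarrow> C1_map S (\<lambda>x. f x + g x)"
  by (rule C1_mapI[where f' = "\<lambda>x. fderiv f x + fderiv g x"])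
    (auto intro!: derivative_eq_intros C1_map_has_derivative continuous_on_add
      simp: blinfun.add_left C1_map_def[THEN iffD1, THEN conjunct2])

lemma C2_map_add:
  assumes "open S" "C2_map S f" "C2_map S g" shows "C2_map S (\<lambda>x. f x + g x)"
proof (rule C2_mapI[OF assms(1), where f' = "\<lambda>x. fderiv f x + fderiv g x"])
  fix x assume "x \<in> S"
  then show "((\<lambda>x. f x + g x) has_derivative blinfun_apply (fderiv f x + fderiv g x)) (at x)"
    by (auto intro!: derivative_eq_intros
        C1_map_has_derivative[OF C2_map_imp_C1_map] assms simp: blinfun.add_left)
qed (use assms in \<open>simp add: C1_map_add C2_map_def\<close>)

lemma C3_map_add:
  assumes "open S" "C3_map S f" "C3_map S g" shows "C3_map S (\<lambda>x. f x + g x)"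
proof (rule C3_mapI[OF assms(1), where f' = "\<lambda>x. fderiv f x + fderiv g x"])
  fix x assume "x \<in> S"
  then show "((\<lambda>x. f x + g x) has_derivative blinfun_apply (fderiv f x + fderiv g x)) (at x)"
    by (auto intro!: derivative_eq_intros
        C1_map_has_derivative[OF C2_map_imp_C1_map[OF C3_map_imp_C2_map]] assms
        simp: blinfun.add_left)
qed (use assms in \<open>simp add: C2_map_add C3_map_def\<close>)

section \<open>Products and linear images of smooth maps\<close>

lemma has_derivative_bilinear_blinfun:
  assumes B: "bounded_bilinear B"
    and f: "(f has_derivative blinfun_apply f') (at x)"
    and g: "(g has_derivative blinfun_apply g') (at x)"
  shows "((\<lambda>x. B (f x) (g x)) has_derivative blinfun_apply
    ((bounded_bilinear.prod_left B (g x) o\<^sub>L f') + (bounded_bilinear.prod_right B (f x) o\<^sub>L g'))) (at x)"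
proof -
  interpret B: bounded_bilinear B by fact
  show ?thesis
    using bounded_bilinear.FDERIV[OF B f g]
    by (simp add: blinfun.add_left[abs_def] add.commute fun_eq_iff has_derivative_eq_rhs)
qed

lemma C1_map_bilinear:
  assumes S: "open S" and B: "bounded_bilinear B" and f: "C1_map S f" and g: "C1_map S g"
  shows "C1_map S (\<lambda>x. B (f x) (g x))"
proof -
  interpret B: bounded_bilinear B by fact
  show ?thesis
  proof (rule C1_mapI[OF S])
    fix x assume x: "x \<in> S"
    show "((\<lambda>x. B (f x) (g x)) has_derivative blinfun_apply
        ((B.prod_left (g x) o\<^sub>L fderiv f x) + (B.prod_right (f x) o\<^sub>L fderiv g x))) (at x)"
      by (rule has_derivative_bilinear_blinfun[OF B C1_map_has_derivative[OF f S x]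
            C1_map_has_derivative[OF g S x]])
  next
    have "continuous_on S f" "continuous_on S g"
      "continuous_on S (fderiv f)" "continuous_on S (fderiv g)"
      using f g by (auto simp: C1_map_continuous C1_map_def)
    then show "continuous_on S
        (\<lambda>x. (B.prod_left (g x) o\<^sub>L fderiv f x) + (B.prod_right (f x) o\<^sub>L fderiv g x))"
      by (intro continuous_on_add bounded_bilinear.continuous_on[OF bounded_bilinear_blinfun_compose]
          bounded_linear.continuous_on[OF B.bounded_linear_prod_left]
          bounded_linear.continuous_on[OF B.bounded_linear_prod_right])
  qed
qed

text \<open>Evaluation is bilinear, and \<open>L (f x)\<close> is the constant operator
  \<open>Blinfun L\<close> evaluated at \<open>f x\<close>.\<close>

lemma C1_map_linear:
  assumes "open S" "bounded_linear L" "C1_map S f"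
  shows "C1_map S (\<lambda>x. L (f x))"
  using C1_map_bilinear[OF assms(1) bounded_bilinear_blinfun_apply C1_map_const[OF assms(1)] assms(3),
      of "Blinfun L"] assms(2)
  by (simp add: bounded_linear_Blinfun_apply)

lemma C2_map_bilinear:
  assumes S: "open S" and B: "bounded_bilinear B" and f: "C2_map S f" and g: "C2_map S g"
  shows "C2_map S (\<lambda>x. B (f x) (g x))"
proof -
  interpret B: bounded_bilinear B by fact
  note f1 = C2_map_imp_C1_map[OF f] and g1 = C2_map_imp_C1_map[OF g]
  show ?thesis
  proof (rule C2_mapI[OF S])
    fix x assume x: "x \<in> S"
    show "((\<lambda>x. B (f x) (g x)) has_derivative blinfun_apply
        ((B.prod_left (g x) o\<^sub>L fderiv f x) + (B.prod_right (f x) o\<^sub>L fderiv g x))) (at x)"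
      by (rule has_derivative_bilinear_blinfun[OF B C1_map_has_derivative[OF f1 S x]
            C1_map_has_derivative[OF g1 S x]])
  next
    have "C1_map S (fderiv f)" "C1_map S (fderiv g)"
      using f g by (auto simp: C2_map_def)
    then show "C1_map S
        (\<lambda>x. (B.prod_left (g x) o\<^sub>L fderiv f x) + (B.prod_right (f x) o\<^sub>L fderiv g x))"
      by (intro C1_map_add C1_map_bilinear[OF _ bounded_bilinear_blinfun_compose] S f1 g1
          C1_map_linear[OF S B.bounded_linear_prod_left] C1_map_linear[OF S B.bounded_linear_prod_right])
  qed
qed

lemma C2_map_linear:
  assumes "open S" "bounded_linear L" "C2_map S f"
  shows "C2_map S (\<lambda>x. L (f x))"
  using C2_map_bilinear[OF assms(1) bounded_bilinear_blinfun_apply C2_map_const[OF assms(1)] assms(3),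
      of "Blinfun L"] assms(2)
  by (simp add: bounded_linear_Blinfun_apply)

lemma C3_map_bilinear:
  assumes S: "open S" and B: "bounded_bilinear B" and f: "C3_map S f" and g: "C3_map S g"
  shows "C3_map S (\<lambda>x. B (f x) (g x))"
proof -
  interpret B: bounded_bilinear B by fact
  note f2 = C3_map_imp_C2_map[OF f] and g2 = C3_map_imp_C2_map[OF g]
  note f1 = C2_map_imp_C1_map[OF f2] and g1 = C2_map_imp_C1_map[OF g2]
  show ?thesis
  proof (rule C3_mapI[OF S])
    fix x assume x: "x \<in> S"
    show "((\<lambda>x. B (f x) (g x)) has_derivative blinfun_apply
        ((B.prod_left (g x) o\<^sub>L fderiv f x) + (B.prod_right (f x) o\<^sub>L fderiv g x))) (at x)"
      by (rule has_derivative_bilinear_blinfun[OF B C1_map_has_derivative[OF f1 S x]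
            C1_map_has_derivative[OF g1 S x]])
  next
    have "C2_map S (fderiv f)" "C2_map S (fderiv g)"
      using f g by (auto simp: C3_map_def)
    then show "C2_map S
        (\<lambda>x. (B.prod_left (g x) o\<^sub>L fderiv f x) + (B.prod_right (f x) o\<^sub>L fderiv g x))"
      by (intro C2_map_add C2_map_bilinear[OF _ bounded_bilinear_blinfun_compose] S f2 g2
          C2_map_linear[OF S B.bounded_linear_prod_left] C2_map_linear[OF S B.bounded_linear_prod_right])
  qed
qed

lemma C3_map_linear:
  assumes "open S" "bounded_linear L" "C3_map S f"
  shows "C3_map S (\<lambda>x. L (f x))"
  using C3_map_bilinear[OF assms(1) bounded_bilinear_blinfun_apply C3_map_const[OF assms(1)] assms(3),
      of "Blinfun L"] assms(2)
  by (simp add: bounded_linear_Blinfun_apply)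

lemma C3_map_bounded_linear:
  assumes "open S" "bounded_linear L" shows "C3_map S L"
  by (rule C3_mapI[where f' = "\<lambda>x. Blinfun L"])
    (use assms in \<open>auto simp: bounded_linear_Blinfun_apply C2_map_const
        intro: bounded_linear.has_derivative[OF _ has_derivative_ident]\<close>)

section \<open>Composition of smooth maps\<close>

lemma has_derivative_compose_blinfun:
  assumes "(f has_derivative blinfun_apply f') (at x)"
    and "(g has_derivative blinfun_apply g') (at (f x))"
  shows "((\<lambda>x. g (f x)) has_derivative blinfun_apply (g' o\<^sub>L f')) (at x)"
  using diff_chain_at[OF assms] by (simp add: comp_def blinfun_compose.rep_eq)

lemma C1_map_compose:
  assumes S: "open S" and T: "open T" and f: "C1_map S f" and g: "C1_map T g"
    and fST: "\<And>x. x \<in> S \<Longrightarrow> f x \<in> T"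
  shows "C1_map S (\<lambda>x. g (f x))"
proof (rule C1_mapI[OF S])
  fix x assume x: "x \<in> S"
  show "((\<lambda>x. g (f x)) has_derivative blinfun_apply (fderiv g (f x) o\<^sub>L fderiv f x)) (at x)"
    by (rule has_derivative_compose_blinfun[OF C1_map_has_derivative[OF f S x]
          C1_map_has_derivative[OF g T fST[OF x]]])
next
  have "continuous_on S (\<lambda>x. fderiv g (f x))"
    using g fST C1_map_continuous[OF f]
    by (auto simp: C1_map_def intro: continuous_on_compose2)
  then show "continuous_on S (\<lambda>x. fderiv g (f x) o\<^sub>L fderiv f x)"
    using f by (auto simp: C1_map_def
        intro: bounded_bilinear.continuous_on[OF bounded_bilinear_blinfun_compose])
qed

lemma C2_map_compose:
  assumes S: "open S" and T: "open T" and f: "C2_map S f" and g: "C2_map T g"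
    and fST: "\<And>x. x \<in> S \<Longrightarrow> f x \<in> T"
  shows "C2_map S (\<lambda>x. g (f x))"
proof (rule C2_mapI[OF S])
  fix x assume x: "x \<in> S"
  show "((\<lambda>x. g (f x)) has_derivative blinfun_apply (fderiv g (f x) o\<^sub>L fderiv f x)) (at x)"
    using C1_map_has_derivative[OF C2_map_imp_C1_map[OF f] S x]
      C1_map_has_derivative[OF C2_map_imp_C1_map[OF g] T fST[OF x]]
    by (rule has_derivative_compose_blinfun)
next
  have "C1_map S (\<lambda>x. fderiv g (f x))"
    using g fST C2_map_imp_C1_map[OF f] by (auto simp: C2_map_def intro: C1_map_compose[OF S T])
  then show "C1_map S (\<lambda>x. fderiv g (f x) o\<^sub>L fderiv f x)"
    using f by (auto simp: C2_map_def intro: C1_map_bilinear[OF S bounded_bilinear_blinfun_compose])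
qed

lemma C3_map_compose:
  assumes S: "open S" and T: "open T" and f: "C3_map S f" and g: "C3_map T g"
    and fST: "\<And>x. x \<in> S \<Longrightarrow> f x \<in> T"
  shows "C3_map S (\<lambda>x. g (f x))"
proof (rule C3_mapI[OF S])
  fix x assume x: "x \<in> S"
  show "((\<lambda>x. g (f x)) has_derivative blinfun_apply (fderiv g (f x) o\<^sub>L fderiv f x)) (at x)"
    using C1_map_has_derivative[OF C2_map_imp_C1_map[OF C3_map_imp_C2_map[OF f]] S x]
      C1_map_has_derivative[OF C2_map_imp_C1_map[OF C3_map_imp_C2_map[OF g]] T fST[OF x]]
    by (rule has_derivative_compose_blinfun)
next
  have "C2_map S (\<lambda>x. fderiv g (f x))"
    using g fST C3_map_imp_C2_map[OF f] by (auto simp: C3_map_def intro: C2_map_compose[OF S T])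
  then show "C2_map S (\<lambda>x. fderiv g (f x) o\<^sub>L fderiv f x)"
    using f by (auto simp: C3_map_def intro: C2_map_bilinear[OF S bounded_bilinear_blinfun_compose])
qed

section \<open>Second derivatives along lines, convexity and cones\<close>

lemma C1_map_line_derivative:
  assumes "open S" "C1_map S g" "p + t *\<^sub>R d \<in> S"
  shows "((\<lambda>t. g (p + t *\<^sub>R d)) has_vector_derivative fderiv g (p + t *\<^sub>R d) d) (at t)"
proof -
  have "((\<lambda>t. p + t *\<^sub>R d) has_derivative (\<lambda>s. s *\<^sub>R d)) (at t)"
    by (auto intro!: derivative_eq_intros)
  from has_derivative_compose[OF this C1_map_has_derivative[OF assms(2,1,3)]]
  show ?thesis by (simp add: has_vector_derivative_def blinfun.scaleR_right)
qed

lemma C1_map_line_real_derivative: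
  fixes g :: "'a::real_normed_vector \<Rightarrow> real"
  assumes "open S" "C1_map S g" "p + t *\<^sub>R d \<in> S"
  shows "((\<lambda>t. g (p + t *\<^sub>R d)) has_real_derivative grad g (p + t *\<^sub>R d) d) (at t)"
  using C1_map_line_derivative[OF assms]
  by (simp add: has_real_derivative_iff_has_vector_derivative)

lemma has_vector_derivative_blinfun_apply:
  assumes "(T has_vector_derivative T') (at t)" "(u has_vector_derivative u') (at t)"
  shows "((\<lambda>t. blinfun_apply (T t) (u t)) has_vector_derivative T' (u t) + T t u') (at t)"
  using blinfun.has_vector_derivative[OF assms] by (simp add: add.commute)

section \<open>Symmetry of second derivatives\<close>

text \<open>Two mean value theorems: one in direction \<open>h\<close> for the increment of
  \<open>f\<close> by \<open>k\<close>, then one in direction \<open>k\<close> for the gradient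
  evaluated at \<open>h\<close>.\<close>

lemma second_difference_mvt:
  fixes f :: "'a::real_normed_vector \<Rightarrow> real"
  assumes S: "open S" and f: "C2_map S f" and sub: "cball x (norm h + norm k) \<subseteq> S"
  shows "\<exists>\<xi>. dist x \<xi> \<le> norm h + norm k \<and>
    f (x + h + k) - f (x + h) - f (x + k) + f x = hess f \<xi> k h"
proof -
  note f1 = C2_map_imp_C1_map[OF f]
  have f2: "C1_map S (grad f)" using f by (simp add: C2_map_def)
  have seg: "dist x (x + b *\<^sub>R h + a *\<^sub>R k) \<le> norm h + norm k" if "0 \<le> a" "a \<le> 1" "0 \<le> b" "b \<le> 1" for a b
  proof -
    have "norm (b *\<^sub>R h + a *\<^sub>R k) \<le> b * norm h + a * norm k"
      using norm_triangle_ineq[of "b *\<^sub>R h" "a *\<^sub>R k"] that by simp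
    also have "\<dots> \<le> norm h + norm k"
      using that by (intro add_mono mult_left_le_one_le) auto
    finally show ?thesis
      using norm_minus_cancel[of "b *\<^sub>R h + a *\<^sub>R k"] by (simp add: dist_norm add.assoc)
  qed
  have mem: "x + b *\<^sub>R h + a *\<^sub>R k \<in> S" if "0 \<le> a" "a \<le> 1" "0 \<le> b" "b \<le> 1" for a b
    using seg[OF that] sub by auto
  let ?g = "\<lambda>\<sigma>. f ((x + k) + \<sigma> *\<^sub>R h) - f (x + \<sigma> *\<^sub>R h)"
  have "\<exists>z::real. z > 0 \<and> z < 1 \<and> ?g 1 - ?g 0 =
      (1 - 0) * (grad f ((x + k) + z *\<^sub>R h) h - grad f (x + z *\<^sub>R h) h)"
  proof (rule MVT2)
    fix \<sigma> :: real assume \<sigma>: "0 \<le> \<sigma>" "\<sigma> \<le> 1"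
    show "(?g has_real_derivative
        grad f ((x + k) + \<sigma> *\<^sub>R h) h - grad f (x + \<sigma> *\<^sub>R h) h) (at \<sigma>)"
      using mem[of 1 \<sigma>] mem[of 0 \<sigma>] \<sigma>
      by (intro derivative_intros C1_map_line_real_derivative[OF S f1]) (auto simp: algebra_simps)
  qed simp
  then obtain z where z: "0 < z" "z < 1"
    and gz: "?g 1 - ?g 0 = grad f ((x + k) + z *\<^sub>R h) h - grad f (x + z *\<^sub>R h) h" by auto
  let ?m = "\<lambda>\<tau>. grad f ((x + z *\<^sub>R h) + \<tau> *\<^sub>R k) h"
  have "\<exists>w::real. w > 0 \<and> w < 1 \<and> ?m 1 - ?m 0 = (1 - 0) * hess f ((x + z *\<^sub>R h) + w *\<^sub>R k) k h"
  proof (rule MVT2)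
    fix \<tau> :: real assume \<tau>: "0 \<le> \<tau>" "\<tau> \<le> 1"
    have "(?m has_vector_derivative hess f ((x + z *\<^sub>R h) + \<tau> *\<^sub>R k) k h
        + grad f ((x + z *\<^sub>R h) + \<tau> *\<^sub>R k) 0) (at \<tau>)"
      using mem[of \<tau> z] \<tau> z
      by (intro has_vector_derivative_blinfun_apply C1_map_line_derivative[OF S f2]) auto
    then show "(?m has_real_derivative hess f ((x + z *\<^sub>R h) + \<tau> *\<^sub>R k) k h) (at \<tau>)"
      by (simp add: has_real_derivative_iff_has_vector_derivative blinfun.zero_right)
  qed simp
  then obtain w where w: "0 < w" "w < 1"
    and mw: "?m 1 - ?m 0 = hess f ((x + z *\<^sub>R h) + w *\<^sub>R k) k h" by auto
  have "f (x + h + k) - f (x + h) - f (x + k) + f x = ?g 1 - ?g 0"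
    by (simp add: algebra_simps)
  also have "\<dots> = ?m 1 - ?m 0" unfolding gz by (simp add: algebra_simps)
  finally show ?thesis using mw seg[of w z] w z by (auto intro!: exI)
qed

text \<open>The second difference does not change when \<open>h\<close> and \<open>k\<close> are
  swapped, so the Hessian at one nearby point on \<open>(k, h)\<close> equals the Hessian at another
  on \<open>(h, k)\<close>. Continuity brings both points to \<open>x\<close>.\<close>

lemma hess_symmetric:
  fixes f :: "'a::real_normed_vector \<Rightarrow> real"
  assumes S: "open S" and f: "C2_map S f" and x: "x \<in> S"
  shows "hess f x h k = hess f x k h"
proof -
  have cont: "isCont (\<lambda>\<xi>. hess f \<xi> u v) x" for u v
  proof -
    have "continuous_on S (\<lambda>\<xi>. hess f \<xi> u v)"
      using f by (auto simp: C2_map_def C1_map_def intro!: continuous_intros)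
    then show ?thesis using S x by (simp add: continuous_on_eq_continuous_at)
  qed
  have "\<bar>hess f x h k - hess f x k h\<bar> \<le> 0 + e" if "e > 0" for e :: real
  proof -
    have "\<forall>\<^sub>F \<xi> in nhds x. \<xi> \<in> S \<and> dist (hess f \<xi> h k) (hess f x h k) < e/2
        \<and> dist (hess f \<xi> k h) (hess f x k h) < e/2"
    proof -
      have lim: "((\<lambda>\<xi>. hess f \<xi> u v) \<longlongrightarrow> hess f x u v) (nhds x)" for u v
        using cont[of u v] unfolding isCont_def by (rule tendsto_at_iff_tendsto_nhds[THEN iffD1])
      have e2: "e / 2 > 0" using \<open>e > 0\<close> by simp
      show ?thesis
        by (rule eventually_conj[OF eventually_nhds_in_open[OF S x]
              eventually_conj[OF tendstoD[OF lim e2] tendstoD[OF lim e2]]])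
    qed
    then obtain \<delta> where \<delta>: "\<delta> > 0" and near: "\<And>\<xi>. dist \<xi> x < \<delta> \<Longrightarrow> \<xi> \<in> S \<and>
        dist (hess f \<xi> h k) (hess f x h k) < e/2 \<and> dist (hess f \<xi> k h) (hess f x k h) < e/2"
      unfolding eventually_nhds_metric by auto
    \<comment> \<open>Scaling both directions by \<open>t\<close> keeps the whole parallelogram
      within distance \<delta> of \<open>x\<close>; the summand 1 excludes a zero
      denominator.\<close>
    define t where "t = \<delta> / (norm h + norm k + 1)"
    have t: "t > 0" "norm (t *\<^sub>R h) + norm (t *\<^sub>R k) < \<delta>"
    proof -
      have pos: "norm h + norm k + 1 > 0" by (simp add: add_nonneg_pos)
      show "t > 0" unfolding t_def using \<delta> pos by simp
      have "norm (t *\<^sub>R h) + norm (t *\<^sub>R k) = t * (norm h + norm k)"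
        using \<open>t > 0\<close> by (simp only: norm_scaleR abs_of_pos distrib_left)
      also have "\<dots> = \<delta> * ((norm h + norm k) / (norm h + norm k + 1))"
        by (simp only: t_def times_divide_eq_left times_divide_eq_right)
      also have "\<dots> < \<delta> * 1" using \<delta> pos by (intro mult_strict_left_mono) auto
      finally show "norm (t *\<^sub>R h) + norm (t *\<^sub>R k) < \<delta>" by simp
    qed
    have sub: "cball x (norm (t *\<^sub>R h) + norm (t *\<^sub>R k)) \<subseteq> S"
      using t(2) near by (auto simp: dist_commute)
    obtain \<xi> where \<xi>: "dist x \<xi> \<le> norm (t *\<^sub>R h) + norm (t *\<^sub>R k)" and e1:
      "f (x + t *\<^sub>R h + t *\<^sub>R k) - f (x + t *\<^sub>R h) - f (x + t *\<^sub>R k) + f x = hess f \<xi> (t *\<^sub>R k) (t *\<^sub>R h)"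
      using second_difference_mvt[OF S f sub] by blast
    obtain \<eta> where \<eta>: "dist x \<eta> \<le> norm (t *\<^sub>R h) + norm (t *\<^sub>R k)" and e2:
      "f (x + t *\<^sub>R k + t *\<^sub>R h) - f (x + t *\<^sub>R k) - f (x + t *\<^sub>R h) + f x = hess f \<eta> (t *\<^sub>R h) (t *\<^sub>R k)"
      using second_difference_mvt[OF S f, of x "t *\<^sub>R k" "t *\<^sub>R h"] sub by (auto simp: add.commute)
    have "hess f \<xi> (t *\<^sub>R k) (t *\<^sub>R h) = hess f \<eta> (t *\<^sub>R h) (t *\<^sub>R k)"
      using e1 e2 by (simp add: add.assoc add.commute[of "t *\<^sub>R h"])
    then have eq: "hess f \<xi> k h = hess f \<eta> h k"
      using t(1) by (simp add: blinfun.bilinear_simps)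
    have "dist (hess f \<eta> h k) (hess f x h k) < e / 2" "dist (hess f \<xi> k h) (hess f x k h) < e / 2"
      using near[of \<eta>] near[of \<xi>] \<xi> \<eta> t(2) by (simp_all only: dist_commute le_less_trans)
    then show ?thesis unfolding eq dist_real_def by linarith
  qed
  then have "\<bar>hess f x h k - hess f x k h\<bar> \<le> 0"
    by (rule field_le_epsilon)
  then show ?thesis by simp
qed

section \<open>Restriction to lines and convexity\<close>

lemma convex_line_preimage:
  assumes "convex S" shows "convex {t::real. p + t *\<^sub>R d \<in> S}"
proof (rule convexI, simp)
  fix x y u v :: real
  assume *: "p + x *\<^sub>R d \<in> S" "p + y *\<^sub>R d \<in> S" "0 \<le> u" "0 \<le> v" "u + v = 1"
  have "u *\<^sub>R (p + x *\<^sub>R d) + v *\<^sub>R (p + y *\<^sub>R d) = (u + v) *\<^sub>R p + (u * x + v * y) *\<^sub>R d"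
    by (simp add: algebra_simps)
  then have "p + (u * x + v * y) *\<^sub>R d = u *\<^sub>R (p + x *\<^sub>R d) + v *\<^sub>R (p + y *\<^sub>R d)"
    using *(5) by simp
  then show "p + (u * x + v * y) *\<^sub>R d \<in> S"
    using convexD[OF assms *] by simp
qed

lemma open_line_preimage:
  fixes p d :: "'a::real_normed_vector"
  assumes "open S" shows "open {t::real. p + t *\<^sub>R d \<in> S}"
proof -
  have "open ((\<lambda>t. p + t *\<^sub>R d) -` S)"
    by (intro open_vimage[OF assms] continuous_on_add continuous_on_scaleR
        continuous_on_const continuous_on_id)
  then show ?thesis by (simp add: vimage_def)
qed

lemma hess_line_derivative:
  fixes f :: "'a::real_normed_vector \<Rightarrow> real"
  assumes S: "open S" and f: "C2_map S f" and t: "p + t *\<^sub>R d \<in> S"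
  shows "((\<lambda>t. grad f (p + t *\<^sub>R d) k) has_real_derivative hess f (p + t *\<^sub>R d) d k) (at t)"
proof -
  have "((\<lambda>t. grad f (p + t *\<^sub>R d) k) has_vector_derivative
      hess f (p + t *\<^sub>R d) d k + grad f (p + t *\<^sub>R d) 0) (at t)"
    using f t by (intro has_vector_derivative_blinfun_apply C1_map_line_derivative[OF S])
      (auto simp: C2_map_def)
  then show ?thesis
    by (simp add: has_real_derivative_iff_has_vector_derivative blinfun.zero_right)
qed

lemma D3_line_derivative:
  fixes f :: "'a::real_normed_vector \<Rightarrow> real"
  assumes S: "open S" and f: "C3_map S f" and t: "p + t *\<^sub>R d \<in> S"
  shows "((\<lambda>t. hess f (p + t *\<^sub>R d) h k) has_real_derivative D3 f (p + t *\<^sub>R d) d h k) (at t)"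
proof -
  have "((\<lambda>t. hess f (p + t *\<^sub>R d) h k) has_vector_derivative
      (D3 f (p + t *\<^sub>R d) d h + hess f (p + t *\<^sub>R d) 0) k + hess f (p + t *\<^sub>R d) h 0) (at t)"
    using f t by (intro has_vector_derivative_blinfun_apply C1_map_line_derivative[OF S])
      (auto simp: C2_map_def C3_map_def)
  then show ?thesis
    by (simp add: has_real_derivative_iff_has_vector_derivative blinfun.zero_right)
qed

lemma convex_on_hess_nonneg:
  fixes f :: "'a::real_normed_vector \<Rightarrow> real"
  assumes S: "open S" "convex S" and f: "C2_map S f"
    and nonneg: "\<And>x h. x \<in> S \<Longrightarrow> hess f x h h \<ge> 0"
  shows "convex_on S f"
proof (rule convex_onI)
  fix t :: real and x y
  assume t: "0 < t" "t < 1" and xy: "x \<in> S" "y \<in> S"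
  let ?I = "{t::real. x + t *\<^sub>R (y - x) \<in> S}"
  have "convex_on ?I (\<lambda>t. f (x + t *\<^sub>R (y - x)))"
  proof (rule f''_ge0_imp_convex[OF convex_line_preimage[OF S(2)]])
    fix t assume "t \<in> ?I"
    then have t: "x + t *\<^sub>R (y - x) \<in> S" by simp
    show "((\<lambda>t. f (x + t *\<^sub>R (y - x))) has_real_derivative
        grad f (x + t *\<^sub>R (y - x)) (y - x)) (at t)"
      by (rule C1_map_line_real_derivative[OF S(1) C2_map_imp_C1_map[OF f] t])
    show "((\<lambda>t. grad f (x + t *\<^sub>R (y - x)) (y - x)) has_real_derivative
        hess f (x + t *\<^sub>R (y - x)) (y - x) (y - x)) (at t)"
      by (rule hess_line_derivative[OF S(1) f t])
    show "0 \<le> hess f (x + t *\<^sub>R (y - x)) (y - x) (y - x)" by (rule nonneg[OF t])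
  qed
  from convex_onD[OF this, of t 0 1] t xy
  have "f (x + t *\<^sub>R (y - x)) \<le> (1 - t) * f x + t * f y" by simp
  moreover have "x + t *\<^sub>R (y - x) = (1 - t) *\<^sub>R x + t *\<^sub>R y"
    by (simp add: algebra_simps)
  ultimately show "f ((1 - t) *\<^sub>R x + t *\<^sub>R y) \<le> (1 - t) * f x + t * f y" by simp
qed (rule S)

text \<open>The one-variable tangent inequality applies to the restriction to the line through
  \<open>x\<close> and \<open>y\<close>, because its parameter set is open and 0 is thus interior to
  it.\<close>

lemma convex_on_tangent_le:
  fixes f :: "'a::real_normed_vector \<Rightarrow> real"
  assumes S: "open S" and f: "C1_map S f" and conv: "convex_on S f" and xy: "x \<in> S" "y \<in> S"
  shows "f x + grad f x (y - x) \<le> f y"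
proof -
  let ?I = "{t::real. x + t *\<^sub>R (y - x) \<in> S}"
  have S': "convex S" using conv by (simp add: convex_on_def)
  have cI: "convex ?I" by (rule convex_line_preimage[OF S'])
  have "convex_on ?I (\<lambda>t. f (x + t *\<^sub>R (y - x)))"
  proof (rule convex_onI[OF _ cI])
    fix t a b :: real
    assume t: "0 < t" "t < 1" and ab: "a \<in> ?I" "b \<in> ?I"
    have "x + ((1 - t) *\<^sub>R a + t *\<^sub>R b) *\<^sub>R (y - x)
        = (1 - t) *\<^sub>R (x + a *\<^sub>R (y - x)) + t *\<^sub>R (x + b *\<^sub>R (y - x))"
      by (simp add: algebra_simps)
    then show "f (x + ((1 - t) *\<^sub>R a + t *\<^sub>R b) *\<^sub>R (y - x))
        \<le> (1 - t) * f (x + a *\<^sub>R (y - x)) + t * f (x + b *\<^sub>R (y - x))"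
      using convex_onD[OF conv, of t] t ab by simp
  qed
  moreover have "((\<lambda>t. f (x + t *\<^sub>R (y - x))) has_real_derivative grad f x (y - x)) (at 0 within ?I)"
    using C1_map_line_real_derivative[OF S f, of x 0 "y - x"] xy
    by (auto intro: has_field_derivative_at_within)
  ultimately show ?thesis
    using convex_on_imp_above_tangent[of ?I "\<lambda>t. f (x + t *\<^sub>R (y - x))" 0 1 "grad f x (y - x)"]
      convex_connected[OF cI] xy interior_open[OF open_line_preimage[OF S, of x "y - x"]]
    by simp
qed

section \<open>Duality of cones and two inequalities\<close>

text \<open>A point outside \<open>K\<close> is strictly separated from it by some \<open>a\<close>;
  as \<open>K\<close> is a cone, \<open>a\<close> must be nonnegative on \<open>K\<close>, so it
  represents an element of the dual cone that is negative at \<open>x\<close>.\<close>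

lemma bipolar_cone:
  fixes K :: "'a::euclidean_space set"
  assumes K: "closed K" "convex_cone K" and x: "\<And>s. s \<in> dual_cone K \<Longrightarrow> blinfun_apply s x \<ge> 0"
  shows "x \<in> K"
proof (rule ccontr)
  assume "x \<notin> K"
  then obtain a b where ab: "a \<bullet> x < b" "\<And>y. y \<in> K \<Longrightarrow> b < a \<bullet> y"
    using separating_hyperplane_closed_point[OF _ K(1)] K(2) by (metis convex_cone_def)
  have "0 \<in> K" using K(2) by (simp add: convex_cone_contains_0)
  then have b: "b < 0" using ab(2) by fastforce
  have "a \<bullet> y \<ge> 0" if "y \<in> K" for y
  proof (rule ccontr)
    assume neg: "\<not> a \<bullet> y \<ge> 0"
    \<comment> \<open>This multiple of \<open>y\<close> lies exactly on the separating hyperplane,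
      against strictness.\<close>
    have "(b / (a \<bullet> y)) *\<^sub>R y \<in> K"
      using neg b that by (intro convex_cone_scaleR[OF K(2)]) (auto simp: divide_nonpos_nonpos)
    from ab(2)[OF this] neg show False by simp
  qed
  then have "blinfun_inner_right a \<in> dual_cone K" by (simp add: dual_cone_def)
  from x[OF this] ab(1) b show False by simp
qed

lemma psd_cauchy_schwarz:
  fixes B :: "'a::real_normed_vector \<Rightarrow>\<^sub>L 'a \<Rightarrow>\<^sub>L real"
  assumes pos: "\<And>h. B h h \<ge> 0" and sym: "\<And>h k. B h k = B k h"
  shows "(B h k)\<^sup>2 \<le> B h h * B k k"
proof -
  have q: "B h h + 2 * t * B h k + t\<^sup>2 * B k k \<ge> 0" for t
    using pos[of "h + t *\<^sub>R k"] sym[of k h]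
    by (simp add: blinfun.bilinear_simps power2_eq_square algebra_simps)
  show ?thesis
  proof (cases "B k k = 0")
    case True
    have q0: "B h h + 2 * t * B h k \<ge> 0" for t using q[of t] True by simp
    have "B h k = 0"
    proof (rule ccontr)
      assume "B h k \<noteq> 0"
      \<comment> \<open>For this \<open>t\<close> the supposedly nonnegative affine function takes
        the value -1.\<close>
      then have "2 * (- (B h h + 1) / (2 * B h k)) * B h k = - (B h h + 1)" by simp
      then show False using q0[of "- (B h h + 1) / (2 * B h k)"] by linarith
    qed
    then show ?thesis using True by simp
  next
    case False
    then have c: "B k k > 0" using pos[of k] by simp
    have "0 \<le> (B h h + 2 * (- B h k / B k k) * B h k + (- B h k / B k k)\<^sup>2 * B k k) * B k k"
      by (rule mult_nonneg_nonneg[OF q less_imp_le[OF c]])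
    also have "\<dots> = B h h * B k k - (B h k)\<^sup>2"
      using c by (simp add: field_simps power2_eq_square)
    finally show ?thesis by simp
  qed
qed

text \<open>With \<open>d\<^sup>2 = p\<^sup>2 + q + r\<^sup>2\<close> and \<open>c = p + r\<close> the left side is \<open>3cd\<^sup>2 - c\<^sup>3\<close>.\<close>

lemma compatibility_inequality:
  fixes p q r :: real
  assumes "p \<ge> 0" "q \<ge> 0" "r \<ge> 0"
  shows "2 * p ^ 3 + 3 * p * q + 3 * r * q + 2 * r ^ 3 \<le> 2 * (p\<^sup>2 + q + r\<^sup>2) powr (3/2)"
proof -
  define d where "d = sqrt (p\<^sup>2 + q + r\<^sup>2)"
  have d: "d \<ge> 0" "d\<^sup>2 = p\<^sup>2 + q + r\<^sup>2" using assms by (auto simp: d_def)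
  \<comment> \<open>With \<open>c = p + r\<close>, the difference
    \<open>2 * d ^ 3 - 3 * c * d\<^sup>2 + c ^ 3\<close> has the double root \<open>d = c\<close>,
    which gives this factorization.\<close>
  have "0 \<le> (d - (p + r))\<^sup>2 * (2 * d + (p + r))" using d(1) assms by simp
  also have "\<dots> = 2 * d ^ 3 - 3 * (p + r) * d\<^sup>2 + (p + r) ^ 3"
    by (simp add: power2_eq_square power3_eq_cube algebra_simps)
  also have "\<dots> = 2 * d ^ 3 - (2 * p ^ 3 + 3 * p * q + 3 * r * q + 2 * r ^ 3)"
    unfolding d(2) by (simp add: power2_eq_square power3_eq_cube algebra_simps)
  also have "d ^ 3 = (d\<^sup>2) powr (3/2)"
  proof (cases "d = 0")
    case False
    then have pos: "d > 0" using d(1) by simp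
    have "(d\<^sup>2) powr (3/2) = (d powr 2) powr (3/2)" using pos by (simp only: powr_numeral)
    also have "\<dots> = d powr 3" by (simp only: powr_powr) simp
    also have "\<dots> = d ^ 3" using pos by (simp only: powr_numeral)
    finally show ?thesis ..
  qed simp
  finally show ?thesis unfolding d(2) by simp
qed

section \<open>Derivatives along lines and curves\<close>

text \<open>Reads off the pure directional derivatives of \<open>f\<close> from an explicit formula
  in one variable. Each identity is established for all parameters of the line inside
  \<open>S\<close>, since it has to be differentiated once more.\<close>

lemma line_derivatives_eqI:
  fixes f :: "'a::real_normed_vector \<Rightarrow> real"
  assumes S: "open S" and f: "C3_map S f" and t: "p + t *\<^sub>R d \<in> S"
    and eq: "\<And>t. p + t *\<^sub>R d \<in> S \<Longrightarrow> f (p + t *\<^sub>R d) = \<phi> t"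
    and \<phi>: "\<And>t. p + t *\<^sub>R d \<in> S \<Longrightarrow> (\<phi> has_real_derivative \<phi>' t) (at t)"
    and d1: "\<And>t. p + t *\<^sub>R d \<in> S \<Longrightarrow> (\<phi>' has_real_derivative \<phi>'' t) (at t)"
    and d2: "\<And>t. p + t *\<^sub>R d \<in> S \<Longrightarrow> (\<phi>'' has_real_derivative \<phi>''' t) (at t)"
  shows "grad f (p + t *\<^sub>R d) d = \<phi>' t" "hess f (p + t *\<^sub>R d) d d = \<phi>'' t"
    "D3 f (p + t *\<^sub>R d) d d d = \<phi>''' t"
proof -
  note f2 = C3_map_imp_C2_map[OF f]
  let ?T = "{t::real. p + t *\<^sub>R d \<in> S}"
  have uniq: "a' = b'"
    if "\<And>t. t \<in> ?T \<Longrightarrow> a t = b t" "(a has_real_derivative a') (at u)"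
      "(b has_real_derivative b') (at u)" "u \<in> ?T"
    for a b :: "real \<Rightarrow> real" and a' b' u :: real
  proof -
    have "(b has_real_derivative a') (at u)"
      using has_field_derivative_transform_within_open[OF that(2) open_line_preimage[OF S] that(4)]
        that(1) by blast
    then show ?thesis using that(3) DERIV_unique by blast
  qed
  have 1: "grad f (p + u *\<^sub>R d) d = \<phi>' u" if u: "p + u *\<^sub>R d \<in> S" for u
    by (rule uniq[OF _ C1_map_line_real_derivative[OF S C2_map_imp_C1_map[OF f2] u] \<phi>[OF u]])
      (use eq u in simp_all)
  have 2: "hess f (p + u *\<^sub>R d) d d = \<phi>'' u" if u: "p + u *\<^sub>R d \<in> S" for u
    by (rule uniq[OF _ hess_line_derivative[OF S f2 u] d1[OF u]]) (use 1 u in simp_all)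
  have 3: "D3 f (p + u *\<^sub>R d) d d d = \<phi>''' u" if u: "p + u *\<^sub>R d \<in> S" for u
    by (rule uniq[OF _ D3_line_derivative[OF S f u] d2[OF u]]) (use 2 u in simp_all)
  show "grad f (p + t *\<^sub>R d) d = \<phi>' t" "hess f (p + t *\<^sub>R d) d d = \<phi>'' t"
    "D3 f (p + t *\<^sub>R d) d d d = \<phi>''' t"
    using 1 2 3 t by simp_all
qed

lemma C1_map_curve_derivative:
  assumes S: "open S" and g: "C1_map S g"
    and y: "(y has_vector_derivative y') (at t)" and yt: "y t \<in> S"
  shows "((\<lambda>t. g (y t)) has_vector_derivative fderiv g (y t) y') (at t)"
  using has_derivative_compose[OF y[unfolded has_vector_derivative_def]
      C1_map_has_derivative[OF g S yt]]
  by (simp add: has_vector_derivative_def blinfun.scaleR_right)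

section \<open>Homogeneity and local norms of self-scaled barriers\<close>

text \<open>The translate of the interior by \<open>k\<close> is an open subset of
  \<open>C\<close>.\<close>

lemma interior_convex_cone_add:
  fixes C :: "'a::real_normed_vector set"
  assumes C: "convex_cone C" and x: "x \<in> interior C" and k: "k \<in> C"
  shows "x + k \<in> interior C"
proof (rule interiorI)
  show "open ((+) k ` interior C)" by (rule open_translation) simp
  show "x + k \<in> (+) k ` interior C" using x by (auto simp: add.commute)
  show "(+) k ` interior C \<subseteq> C"
    using interior_subset[of C] by (auto intro!: convex_cone_add[OF C k])
qed

lemma interior_convex_cone_scaleR:
  fixes C :: "'a::real_normed_vector set"
  assumes C: "convex_cone C" and x: "x \<in> interior C" and r: "r > 0"
  shows "r *\<^sub>R x \<in> interior C"
proof (rule interiorI)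
  show "open ((*\<^sub>R) r ` interior C)" using r by (intro open_scaling) auto
  show "r *\<^sub>R x \<in> (*\<^sub>R) r ` interior C" using x by auto
  show "(*\<^sub>R) r ` interior C \<subseteq> C"
    using interior_subset[of C] r by (auto intro!: convex_cone_scaleR[OF C])
qed

lemma convex_cone_dual_cone: "convex_cone (dual_cone K)"
  unfolding convex_cone_iff dual_cone_def by (auto simp: blinfun.bilinear_simps)

text \<open>The coordinate map \<open>V\<close> identifies the dual with the space itself, so
  \<open>V\<close> after \<open>A\<close> is an injective endomorphism in finite dimension and has
  an inverse \<open>G\<close>. Then \<open>G\<close> after \<open>V\<close> inverts
  \<open>A\<close>.\<close>

lemma blinfun_to_dual_inverse:
  fixes A :: "'a::euclidean_space \<Rightarrow>\<^sub>L 'a \<Rightarrow>\<^sub>L real"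
  assumes inj: "\<And>h. A h = 0 \<Longrightarrow> h = 0"
  obtains B :: "('a \<Rightarrow>\<^sub>L real) \<Rightarrow>\<^sub>L 'a" where "\<And>x. B (A x) = x" "\<And>s. A (B s) = s"
proof -
  define V :: "('a \<Rightarrow>\<^sub>L real) \<Rightarrow> 'a" where "V s = (\<Sum>b\<in>Basis. blinfun_apply s b *\<^sub>R b)" for s
  have blV: "bounded_linear V" unfolding V_def
    by (rule bounded_linear_sum)
      (rule bounded_linear_compose[OF bounded_linear_scaleR_left blinfun.bounded_linear_left])
  have Vb: "V s \<bullet> b = blinfun_apply s b" if "b \<in> Basis" for s b
    unfolding V_def by (rule inner_sum_left_Basis[OF that])
  have Vinj: "s = t" if "V s = V t" for s t
    by (rule blinfun_euclidean_eqI) (simp only: Vb[symmetric] that)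
  have lin: "linear (\<lambda>x. V (A x))"
    using bounded_linear_compose[OF blV blinfun.bounded_linear_right[of A]]
    by (rule bounded_linear.linear)
  have "inj (\<lambda>x. V (A x))"
  proof (rule injI)
    fix x y assume "V (A x) = V (A y)"
    then have "A (x - y) = 0" using Vinj by (simp add: blinfun.diff_right)
    from inj[OF this] show "x = y" by simp
  qed
  then obtain G where G: "linear G" "\<And>x. G (V (A x)) = x" "\<And>x. V (A (G x)) = x"
    using linear_injective_isomorphism[OF lin] by blast
  have "bounded_linear (\<lambda>s. G (V s))"
    using bounded_linear_compose[OF linear_conv_bounded_linear[THEN iffD1, OF G(1)] blV] .
  then have ap: "blinfun_apply (Blinfun (\<lambda>s. G (V s))) s = G (V s)" for s
    by (simp add: bounded_linear_Blinfun_apply)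
  show ?thesis
    by (rule that[of "Blinfun (\<lambda>s. G (V s))"]) (simp_all only: ap G(2) Vinj[OF G(3)])
qed

locale smooth_self_scaled_barrier =
  fixes K :: "'a::euclidean_space set" and F :: "'a \<Rightarrow> real" and \<nu> :: real
  assumes proper: "proper_cone K"
    and self_scaled: "self_scaled_barrier K \<nu> F"
    and C4: "C4_on (interior K) F"
begin

abbreviation "I \<equiv> interior K"

lemma K_closed: "closed K" and K_cone: "convex_cone K" and I_nonempty: "I \<noteq> {}"
  and no_line: "d \<noteq> 0 \<Longrightarrow> \<exists>t::real. x + t *\<^sub>R d \<notin> K"
  using proper unfolding proper_cone_def by blast+

lemma I_convex: "convex I"
  using K_cone by (auto simp: convex_cone_def intro: convex_interior)

lemmas I_add = interior_convex_cone_add[OF K_cone]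
lemmas I_scaleR = interior_convex_cone_scaleR[OF K_cone]

lemma I_sub: "x \<in> I \<Longrightarrow> x \<in> K"
  using interior_subset by blast

lemma sc: "self_concordant_barrier I F \<nu>"
  using self_scaled
  by (simp add: self_scaled_barrier_def normal_barrier_def self_concordant_barrier_for_def)

lemma nu_ge_1: "\<nu> \<ge> 1"
  using sc by (simp add: self_concordant_barrier_def)

lemma grad_F_C3: "C3_map I (grad F)"
  using C4 by (simp add: C4_on_iff_C3_map)

lemma F_C3: "C3_map I F"
  using C4 C3_map_imp_C2_map[OF grad_F_C3] by (simp add: C4_on_iff_C3_map C3_map_def)

lemmas F_C2 = C3_map_imp_C2_map[OF F_C3]
lemmas F_C1 = C2_map_imp_C1_map[OF F_C2]
lemmas grad_F_C2 = C3_map_imp_C2_map[OF grad_F_C3]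
lemmas grad_F_C1 = C2_map_imp_C1_map[OF grad_F_C2]

lemma hess_F_C2: "C2_map I (hess F)"
  using grad_F_C3 by (simp add: C3_map_def)

lemmas hess_F_C1 = C2_map_imp_C1_map[OF hess_F_C2]

lemma D3_F_C1: "C1_map I (D3 F)"
  using hess_F_C2 by (simp add: C2_map_def)

lemma F_tangent: "x \<in> I \<Longrightarrow> y \<in> I \<Longrightarrow> F x + grad F x (y - x) \<le> F y"
  by (rule convex_on_tangent_le[OF open_interior F_C1])
    (use sc in \<open>auto simp: self_concordant_barrier_def self_concordant_def\<close>)

text \<open>Closedness of the epigraph in the form used throughout: bounded values of
  \<open>F\<close> keep a limit away from the boundary of \<open>K\<close>.\<close>

lemma F_bounded_limit:
  assumes X: "\<And>n. X n \<in> I" "\<And>n. F (X n) \<le> M" and lim: "X \<longlonglongrightarrow> x"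
  shows "x \<in> I"
proof -
  have "closed (epigraph I F)"
    using sc by (simp add: self_concordant_barrier_def self_concordant_def)
  moreover have "(\<lambda>n. (X n, M)) \<longlonglongrightarrow> (x, M)" by (intro tendsto_intros lim)
  moreover have "(X n, M) \<in> epigraph I F" for n using X by (simp add: mem_epigraph)
  ultimately have "(x, M) \<in> epigraph I F" by (metis closed_sequentially)
  then show ?thesis by (simp add: mem_epigraph)
qed

lemma F_D3_le: "x \<in> I \<Longrightarrow> D3 F x h h h \<le> 2 * (hess F x h h) powr (3/2)"
  using sc by (simp add: self_concordant_barrier_def self_concordant_def)

lemma F_grad_sq_le: "x \<in> I \<Longrightarrow> (grad F x h)\<^sup>2 \<le> \<nu> * hess F x h h"
  using sc by (simp add: self_concordant_barrier_def)

text \<open>The barrier inequality puts a square below \<nu> times the Hessian form.\<close>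

lemma hess_F_nonneg:
  assumes "x \<in> I" shows "hess F x h h \<ge> 0"
proof -
  have "0 \<le> \<nu> * hess F x h h"
    using F_grad_sq_le[OF assms, of h] zero_le_power2[of "grad F x h"] by linarith
  then show ?thesis using nu_ge_1 by (simp add: zero_le_mult_iff)
qed

lemma hess_F_sym: "x \<in> I \<Longrightarrow> hess F x h k = hess F x k h"
  by (rule hess_symmetric[OF open_interior F_C2])

text \<open>This is the symmetry of the Hessian of the scalar function
  \<open>y \<mapsto> grad F y p\<close>.\<close>

lemma D3_F_sym: assumes x: "x \<in> I" shows "D3 F x h k = D3 F x k h"
proof (rule blinfun_eqI)
  fix p
  define f where "f y = grad F y p" for y
  have f1: "(f has_derivative blinfun_apply (Blinfun (\<lambda>h. hess F y h p))) (at y)" if "y \<in> I" for y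
  proof -
    have "(f has_derivative (\<lambda>h. hess F y h p)) (at y)" unfolding f_def
      by (rule bounded_linear.has_derivative[OF blinfun.bounded_linear_left
            C1_map_has_derivative[OF grad_F_C1 open_interior that]])
    moreover from this have "bounded_linear (\<lambda>h. hess F y h p)" by (rule has_derivative_bounded_linear)
    ultimately show ?thesis by (simp add: bounded_linear_Blinfun_apply)
  qed
  have f2: "C2_map I f" unfolding f_def
    by (rule C2_map_linear[OF open_interior blinfun.bounded_linear_left grad_F_C2])
  have g: "grad f y k = hess F y k p" if "y \<in> I" for y k
    using fderiv_eqI[OF f1[OF that]] has_derivative_bounded_linear[OF f1[OF that]]
      bounded_linear_Blinfun_apply[of "\<lambda>h. hess F y h p"]
      bounded_linear_compose[OF blinfun.bounded_linear_left[of p] blinfun.bounded_linear_right[of "hess F y"]]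
    by simp
  have "hess f x h k = D3 F x h k p" for h k
  proof -
    have x0: "x + 0 *\<^sub>R h \<in> I" using x by simp
    have "((\<lambda>t. grad f (x + t *\<^sub>R h) k) has_real_derivative D3 F x h k p) (at 0)"
      using D3_line_derivative[OF open_interior F_C3 x0, of k p]
      by (rule DERIV_cong_ev[THEN iffD1, rotated -1])
        (use g open_line_preimage[OF open_interior, of x h K] x in \<open>auto simp: eventually_nhds\<close>)
    moreover have "((\<lambda>t. grad f (x + t *\<^sub>R h) k) has_real_derivative hess f x h k) (at 0)"
      using hess_line_derivative[OF open_interior f2 x0] by simp
    ultimately show ?thesis by (rule DERIV_unique[symmetric])
  qed
  then show "D3 F x h k p = D3 F x k h p"
    using hess_symmetric[OF open_interior f2 x] by metis
qed

section \<open>Logarithmic homogeneity and Euler identities\<close>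

lemma F_scaleR: "x \<in> I \<Longrightarrow> r > 0 \<Longrightarrow> F (r *\<^sub>R x) = F x - \<nu> * ln r"
  using self_scaled by (simp add: self_scaled_barrier_def normal_barrier_def)

text \<open>The identity \<open>F_scaleR\<close> is differentiated in \<open>x\<close>. Moving the
  scaled point in direction \<open>r *\<^sub>R h\<close> matches moving \<open>x\<close> in
  direction \<open>h\<close>.\<close>

lemma grad_F_scaleR:
  assumes x: "x \<in> I" and r: "r > 0"
  shows "grad F (r *\<^sub>R x) = (1 / r) *\<^sub>R grad F x"
proof (rule blinfun_eqI)
  fix h
  have x0: "x + 0 *\<^sub>R h \<in> I" and rx: "r *\<^sub>R x + 0 *\<^sub>R (r *\<^sub>R h) \<in> I"
    using x I_scaleR[OF x r] by simp_all
  have "((\<lambda>t. F (r *\<^sub>R x + t *\<^sub>R (r *\<^sub>R h))) has_real_derivative grad F x h) (at 0)"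
  proof (rule DERIV_cong_ev[THEN iffD1, rotated -1])
    show "((\<lambda>t. F (x + t *\<^sub>R h) - \<nu> * ln r) has_real_derivative grad F x h) (at 0)"
      using C1_map_line_real_derivative[OF open_interior F_C1 x0]
      by (auto intro!: derivative_eq_intros)
    have "\<forall>\<^sub>F t in nhds 0. t \<in> {t::real. x + t *\<^sub>R h \<in> I}"
      using x by (intro eventually_nhds_in_open open_line_preimage) auto
    then show "\<forall>\<^sub>F t in nhds 0. F (x + t *\<^sub>R h) - \<nu> * ln r = F (r *\<^sub>R x + t *\<^sub>R (r *\<^sub>R h))"
    proof eventually_elim
      case (elim t)
      then show ?case using F_scaleR[of "x + t *\<^sub>R h" r] r by (simp add: scaleR_add_right mult.commute)
    qed
  qed simp_all
  moreover have "((\<lambda>t. F (r *\<^sub>R x + t *\<^sub>R (r *\<^sub>R h))) has_real_derivative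
      grad F (r *\<^sub>R x) (r *\<^sub>R h)) (at 0)"
    using C1_map_line_real_derivative[OF open_interior F_C1 rx] by simp
  ultimately have "grad F x h = r * grad F (r *\<^sub>R x) h"
    using DERIV_unique by (fastforce simp: blinfun.bilinear_simps)
  then show "grad F (r *\<^sub>R x) h = blinfun_apply ((1 / r) *\<^sub>R grad F x) h"
    using r by (simp add: blinfun.bilinear_simps)
qed

lemma hess_F_scaleR:
  assumes x: "x \<in> I" and r: "r > 0"
  shows "hess F (r *\<^sub>R x) = (1 / r\<^sup>2) *\<^sub>R hess F x"
proof (intro blinfun_eqI)
  fix h k
  have x0: "x + 0 *\<^sub>R h \<in> I" and rx: "r *\<^sub>R x + 0 *\<^sub>R (r *\<^sub>R h) \<in> I"
    using x I_scaleR[OF x r] by simp_all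
  have "((\<lambda>t. grad F (r *\<^sub>R x + t *\<^sub>R (r *\<^sub>R h)) k) has_real_derivative (1 / r) * hess F x h k) (at 0)"
  proof (rule DERIV_cong_ev[THEN iffD1, rotated -1])
    show "((\<lambda>t. (1 / r) * grad F (x + t *\<^sub>R h) k) has_real_derivative (1 / r) * hess F x h k) (at 0)"
      using DERIV_cmult[OF hess_line_derivative[OF open_interior F_C2 x0], of "1 / r"] by simp
    have "\<forall>\<^sub>F t in nhds 0. t \<in> {t::real. x + t *\<^sub>R h \<in> I}"
      using x by (intro eventually_nhds_in_open open_line_preimage) auto
    then show "\<forall>\<^sub>F t in nhds 0.
        (1 / r) * grad F (x + t *\<^sub>R h) k = grad F (r *\<^sub>R x + t *\<^sub>R (r *\<^sub>R h)) k"
    proof eventually_elim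
      case (elim t)
      then have "grad F (r *\<^sub>R (x + t *\<^sub>R h)) = (1 / r) *\<^sub>R grad F (x + t *\<^sub>R h)"
        using r by (intro grad_F_scaleR) auto
      then show ?case by (simp add: scaleR_add_right mult.commute blinfun.bilinear_simps)
    qed
  qed simp_all
  moreover have "((\<lambda>t. grad F (r *\<^sub>R x + t *\<^sub>R (r *\<^sub>R h)) k) has_real_derivative
      hess F (r *\<^sub>R x) (r *\<^sub>R h) k) (at 0)"
    using hess_line_derivative[OF open_interior F_C2 rx] by simp
  ultimately have "(1 / r) * hess F x h k = r * hess F (r *\<^sub>R x) h k"
    using DERIV_unique by (fastforce simp: blinfun.bilinear_simps)
  then show "hess F (r *\<^sub>R x) h k = ((1 / r\<^sup>2) *\<^sub>R hess F x) h k"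
    using r by (simp add: blinfun.bilinear_simps field_simps power2_eq_square)
qed

text \<open>Euler's identity: both sides are the derivative of \<open>G\<close> along the ray
  through \<open>x\<close>, at parameter 1.\<close>

lemma homogeneous_derivative:
  fixes G :: "'a \<Rightarrow> 'b::real_normed_vector"
  assumes G: "C1_map I G" and x: "x \<in> I"
    and hom: "\<And>r. r > 0 \<Longrightarrow> G (r *\<^sub>R x) = \<phi> r *\<^sub>R c"
    and \<phi>: "(\<phi> has_real_derivative \<phi>') (at 1)"
  shows "fderiv G x x = \<phi>' *\<^sub>R c"
proof -
  have "((\<lambda>t. G (0 + t *\<^sub>R x)) has_vector_derivative fderiv G (0 + 1 *\<^sub>R x) x) (at 1)"
    using x by (intro C1_map_line_derivative[OF open_interior G]) simp
  then have "((\<lambda>t. G (t *\<^sub>R x)) has_vector_derivative fderiv G x x) (at 1)" by simp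
  moreover have "((\<lambda>t. \<phi> t *\<^sub>R c) has_vector_derivative \<phi>' *\<^sub>R c) (at 1)"
    using has_vector_derivative_scaleR[OF \<phi> has_vector_derivative_const[of c]] by simp
  then have "((\<lambda>t. G (t *\<^sub>R x)) has_vector_derivative \<phi>' *\<^sub>R c) (at 1)"
    by (rule has_vector_derivative_transform_within_open[of _ _ _ "{0<..}"]) (auto simp: hom)
  ultimately show ?thesis by (rule vector_derivative_unique_at)
qed

lemma inverse_square_derivative: "((\<lambda>r::real. 1 / r\<^sup>2) has_real_derivative -2) (at 1)"
  by (rule derivative_eq_intros | simp)+

lemma hess_F_self: "x \<in> I \<Longrightarrow> hess F x x = - grad F x"
  using homogeneous_derivative[OF grad_F_C1 _ grad_F_scaleR, of x "-1"] DERIV_inverse[of "1::real"]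
  by (simp add: inverse_eq_divide)

lemma D3_F_self: "x \<in> I \<Longrightarrow> D3 F x x = (-2) *\<^sub>R hess F x"
  using homogeneous_derivative[OF hess_F_C1 _ hess_F_scaleR, of x "-2"] inverse_square_derivative
  by simp

lemma grad_F_self:
  assumes x: "x \<in> I" shows "grad F x x = - \<nu>"
proof -
  have x0: "0 + 1 *\<^sub>R x \<in> I" using x by simp
  have "((\<lambda>t. F (0 + t *\<^sub>R x)) has_real_derivative grad F x x) (at 1)"
    using C1_map_line_real_derivative[OF open_interior F_C1 x0] by simp
  moreover have "((\<lambda>t. F (0 + t *\<^sub>R x)) has_real_derivative - \<nu>) (at 1)"
  proof (rule DERIV_cong_ev[THEN iffD1, rotated -1])
    show "((\<lambda>t. F x - \<nu> * ln t) has_real_derivative - \<nu>) (at 1)"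
      by (auto intro!: derivative_eq_intros)
    have "\<forall>\<^sub>F t in nhds 1. t \<in> {0::real<..}"
      by (intro eventually_nhds_in_open) auto
    then show "\<forall>\<^sub>F t in nhds 1. F x - \<nu> * ln t = F (0 + t *\<^sub>R x)"
      by eventually_elim (simp add: F_scaleR[OF x])
  qed simp_all
  ultimately show ?thesis by (rule DERIV_unique)
qed

section \<open>Definiteness of the Hessian and gradient bounds on local norms\<close>

lemma self_scaledD:
  assumes "w \<in> I" "x \<in> I"
  shows "hess F w x \<in> interior (dual_cone K)"
    and "dual_barrier K F (hess F w x) = F x - 2 * F w - \<nu>"
  using self_scaled assms by (auto simp: self_scaled_barrier_def)

text \<open>If \<open>h\<close> is in the kernel of the Hessian at \<open>w\<close>, then the self-scaling identity makes \<open>F\<close>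
  constant along \<open>w + th\<close>, and this line cannot leave the domain of the closed function \<open>F\<close>.\<close>

lemma hess_F_inj:
  assumes w: "w \<in> I" and h: "hess F w h = 0"
  shows "h = 0"
proof -
  let ?T = "{t::real. w + t *\<^sub>R h \<in> I}"
  \<comment> \<open>The Hessian at \<open>w\<close> sends \<open>w + t *\<^sub>R h\<close> and
    \<open>w\<close> to the same functional, so the two self-scaling identities share their left
    side.\<close>
  have const: "F (w + t *\<^sub>R h) = F w" if "t \<in> ?T" for t
    using self_scaledD(2)[OF w, of "w + t *\<^sub>R h"] self_scaledD(2)[OF w w] that
    by (simp add: h blinfun.bilinear_simps)
  have "closed ?T"
    unfolding closed_sequential_limits
  proof (intro allI impI, elim conjE)
    fix X t assume X: "\<forall>n. X n \<in> ?T" "X \<longlonglongrightarrow> t"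
    have "(\<lambda>n. w + X n *\<^sub>R h) \<longlonglongrightarrow> w + t *\<^sub>R h" by (intro tendsto_intros X)
    from F_bounded_limit[OF _ _ this, of "F w"] X(1) const show "t \<in> ?T" by simp
  qed
  moreover have "open ?T" by (rule open_line_preimage[OF open_interior])
  moreover have "0 \<in> ?T" using w by simp
  ultimately have T: "?T = UNIV" using clopen[of ?T] by blast
  have "w + t *\<^sub>R h \<in> K" for t
  proof -
    have "t \<in> ?T" unfolding T by (rule UNIV_I)
    then show ?thesis by (intro I_sub) (simp only: mem_Collect_eq)
  qed
  then show ?thesis using no_line[of h w] by blast
qed

lemma hess_F_cauchy_schwarz:
  "x \<in> I \<Longrightarrow> (hess F x h k)\<^sup>2 \<le> hess F x h h * hess F x k k"
  by (rule psd_cauchy_schwarz[OF hess_F_nonneg hess_F_sym])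

text \<open>By Cauchy-Schwarz a null vector of the form lies in the kernel of the Hessian, which is
  trivial.\<close>

lemma hess_F_pos:
  assumes x: "x \<in> I" and h: "h \<noteq> 0"
  shows "hess F x h h > 0"
proof (rule ccontr)
  assume "\<not> hess F x h h > 0"
  then have z: "hess F x h h = 0" using hess_F_nonneg[OF x, of h] by simp
  have "hess F x h = 0"
  proof (rule blinfun_eqI)
    fix k show "hess F x h k = blinfun_apply 0 k"
      using hess_F_cauchy_schwarz[OF x, of h k] z by simp
  qed
  then show False using hess_F_inj[OF x] h by blast
qed

text \<open>The definition bounds the cubic form only from above; the lower bound is the upper one
  at \<open>- h\<close>.\<close>

lemma F_D3_bounds:
  assumes x: "x \<in> I"
  shows "- 2 * (sqrt (hess F x h h)) ^ 3 \<le> D3 F x h h h"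
    and "D3 F x h h h \<le> 2 * (sqrt (hess F x h h)) ^ 3"
proof -
  have p: "a powr (3/2) = (sqrt a) ^ 3" if "a \<ge> 0" for a :: real
  proof (cases "a = 0")
    case False
    then have pos: "a > 0" using that by simp
    have "(sqrt a) ^ 3 = (a powr (1/2)) powr 3" using pos by (simp only: powr_half_sqrt powr_numeral real_sqrt_gt_zero less_imp_le)
    also have "\<dots> = a powr (3/2)" by (simp only: powr_powr) simp
    finally show ?thesis ..
  qed simp
  show "D3 F x h h h \<le> 2 * (sqrt (hess F x h h)) ^ 3"
    using F_D3_le[OF x, of h] p[OF hess_F_nonneg[OF x, of h]] by simp
  show "- 2 * (sqrt (hess F x h h)) ^ 3 \<le> D3 F x h h h"
    using F_D3_le[OF x, of "-h"] p[OF hess_F_nonneg[OF x, of h]]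
    by (simp add: blinfun.bilinear_simps)
qed

text \<open>By self-concordance the derivative of \<open>\<langle>\<nabla>F(x + tk), k\<rangle> + \<parallel>k\<parallel>\<^bsub>x + tk\<^esub>\<close> in \<open>t\<close> is nonnegative, and
  by homogeneity this function tends to 0.\<close>

lemma local_norm_le_interior:
  assumes x: "x \<in> I" and k: "k \<in> I"
  shows "sqrt (hess F x k k) \<le> - grad F x k"
proof (cases "k = 0")
  case False
  define g where "g t = grad F (x + t *\<^sub>R k) k + sqrt (hess F (x + t *\<^sub>R k) k k)" for t
  have xt: "x + t *\<^sub>R k \<in> I" if "t \<ge> 0" for t
    using that k by (intro I_add[OF x] convex_cone_scaleR[OF K_cone] I_sub)
  have mono: "g 0 \<le> g t" if "t \<ge> 0" for t
  proof (rule DERIV_nonneg_imp_nondecreasing[OF that])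
    fix u :: real assume u: "0 \<le> u"
    let ?y = "x + u *\<^sub>R k"
    define s where "s = sqrt (hess F ?y k k)"
    have s: "s > 0" "s\<^sup>2 = hess F ?y k k"
      using hess_F_pos[OF xt[OF u] False] by (auto simp: s_def)
    have "(g has_real_derivative hess F ?y k k + D3 F ?y k k k * (inverse s / 2)) (at u)"
      unfolding g_def s_def using xt[OF u] hess_F_pos[OF xt[OF u] False]
      by (auto intro!: derivative_eq_intros hess_line_derivative[OF open_interior F_C2]
          D3_line_derivative[OF open_interior F_C3])
    \<comment> \<open>The square root contributes at least \<open>- s\<^sup>2\<close>, which the
      Hessian term cancels exactly.\<close>
    moreover have "hess F ?y k k + D3 F ?y k k k * (inverse s / 2) \<ge> 0"
    proof -
      have "- 2 * s ^ 3 \<le> D3 F ?y k k k" unfolding s_def by (rule F_D3_bounds[OF xt[OF u]])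
      then have "- 2 * s ^ 3 * (inverse s / 2) \<le> D3 F ?y k k k * (inverse s / 2)"
        using s by (intro mult_right_mono) auto
      moreover have "- 2 * s ^ 3 * (inverse s / 2) = - s\<^sup>2"
        using s by (simp add: power2_eq_square power3_eq_cube)
      ultimately show ?thesis using s(2) by linarith
    qed
    ultimately show "\<exists>y. (g has_real_derivative y) (at u) \<and> 0 \<le> y" by blast
  qed
  \<comment> \<open>Writing \<open>x + r *\<^sub>R k\<close> as \<open>r\<close> times
    \<open>k + inverse r *\<^sub>R x\<close> gives \<open>g r = inverse r * G (inverse r)\<close> by
    homogeneity. Since \<open>k\<close> is interior, \<open>G\<close> is continuous at 0, and so
    \<open>g\<close> tends to 0.\<close>
  define G where "G u = grad F (k + u *\<^sub>R x) k + sqrt (hess F (k + u *\<^sub>R x) k k)" for u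
  have gG: "g (real (Suc n)) = inverse (real (Suc n)) * G (inverse (real (Suc n)))" for n
  proof -
    define r where "r = real (Suc n)"
    have r: "r > 0" by (simp add: r_def)
    have ki: "k + inverse r *\<^sub>R x \<in> I"
      using r x by (intro I_add[OF k] convex_cone_scaleR[OF K_cone] I_sub) auto
    have eq: "x + r *\<^sub>R k = r *\<^sub>R (k + inverse r *\<^sub>R x)"
      using r by (simp add: algebra_simps)
    show ?thesis
      unfolding r_def[symmetric] g_def G_def eq grad_F_scaleR[OF ki r] hess_F_scaleR[OF ki r]
      using r by (simp add: blinfun.bilinear_simps real_sqrt_divide real_sqrt_mult algebra_simps
          divide_inverse real_sqrt_inverse)
  qed
  have cont: "isCont G 0"
  proof -
    have line: "isCont (\<lambda>u. k + u *\<^sub>R x) 0" by (intro continuous_intros)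
    have "isCont (grad F) (k + 0 *\<^sub>R x)" "isCont (hess F) (k + 0 *\<^sub>R x)"
      using C1_map_continuous[OF grad_F_C1] C1_map_continuous[OF hess_F_C1] k
      by (auto simp: continuous_on_eq_continuous_at)
    from isCont_o2[OF line this(1)] isCont_o2[OF line this(2)]
    show ?thesis unfolding G_def by (intro continuous_intros)
  qed
  have inv: "(\<lambda>n. inverse (real (Suc n))) \<longlonglongrightarrow> 0" by (rule LIMSEQ_inverse_real_of_nat)
  have "(\<lambda>n. g (real (Suc n))) \<longlonglongrightarrow> 0 * G 0"
    unfolding gG by (intro tendsto_mult inv isCont_tendsto_compose[OF cont])
  then have "g 0 \<le> 0"
    using LIMSEQ_le_const[of "\<lambda>n. g (real (Suc n))" 0 "g 0"] mono by auto
  then show ?thesis by (simp add: g_def)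
qed (simp add: blinfun.bilinear_simps)

text \<open>A point of \<open>K\<close> is the limit of the interior points obtained by adding small
  multiples of \<open>x\<close>, and both sides are continuous in \<open>k\<close>.\<close>

lemma local_norm_le:
  assumes x: "x \<in> I" and k: "k \<in> K"
  shows "sqrt (hess F x k k) \<le> - grad F x k"
proof -
  define X where "X n = k + inverse (real (Suc n)) *\<^sub>R x" for n
  have "X n \<in> I" for n
    unfolding X_def using I_add[OF I_scaleR[OF x] k, of "inverse (real (Suc n))"]
    by (simp add: add.commute)
  then have le: "sqrt (hess F x (X n) (X n)) \<le> - grad F x (X n)" for n
    by (rule local_norm_le_interior[OF x])
  have "X \<longlonglongrightarrow> k + 0 *\<^sub>R x"
    unfolding X_def by (intro tendsto_intros LIMSEQ_inverse_real_of_nat)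
  then have X: "X \<longlonglongrightarrow> k" by simp
  show ?thesis
    by (rule LIMSEQ_le[of "\<lambda>n. sqrt (hess F x (X n) (X n))" _ "\<lambda>n. - grad F x (X n)"])
      (auto intro!: tendsto_intros X le)
qed

lemma grad_F_nonpos:
  assumes x: "x \<in> I" and k: "k \<in> K"
  shows "grad F x k \<le> 0"
proof -
  have "0 \<le> sqrt (hess F x k k)" by (simp add: hess_F_nonneg[OF x])
  then show ?thesis using local_norm_le[OF x k] by linarith
qed

end

section \<open>The dual barrier\<close>

locale self_scaled_point = smooth_self_scaled_barrier +
  fixes w assumes w: "w \<in> interior K"
begin

abbreviation "A \<equiv> hess F w"
abbreviation "J \<equiv> interior (dual_cone K)"

definition Ai :: "('a \<Rightarrow>\<^sub>L real) \<Rightarrow>\<^sub>L 'a"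
  where "Ai = (SOME B. (\<forall>x. blinfun_apply B (A x) = x) \<and> (\<forall>s. A (blinfun_apply B s) = s))"

lemma Ai_A: "Ai (A x) = x" and A_Ai: "A (Ai s) = s"
proof -
  have "\<exists>B :: ('a \<Rightarrow>\<^sub>L real) \<Rightarrow>\<^sub>L 'a. (\<forall>x. B (A x) = x) \<and> (\<forall>s. A (B s) = s)"
    using blinfun_to_dual_inverse[OF hess_F_inj[OF w]] by metis
  from someI_ex[OF this] show "Ai (A x) = x" "A (Ai s) = s" by (auto simp: Ai_def)
qed

lemma Ai_sym: "blinfun_apply s (Ai t) = blinfun_apply t (Ai s)"
  using hess_F_sym[OF w, of "Ai s" "Ai t"] by (simp add: A_Ai)

lemma J_convex: "convex J"
  using convex_cone_dual_cone by (auto simp: convex_cone_def intro: convex_interior)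

lemma A_mem_J: "x \<in> I \<Longrightarrow> A x \<in> J"
  by (rule self_scaledD[OF w])

text \<open>The bound comes from the tangent of \<open>F\<close> at \<open>w\<close>: it suffices that \<open>s' + \<delta>\<nabla>F(w) \<in> K\<^sup>*\<close>.\<close>

lemma dual_barrier_locally_bounded:
  assumes s: "s \<in> J"
  shows "\<exists>M. \<forall>\<^sub>F s' in nhds s. dual_barrier K F s' \<le> M"
proof -
  have "open {t::real. s + t *\<^sub>R grad F w \<in> J}" by (rule open_line_preimage) simp
  moreover have "0 \<in> {t::real. s + t *\<^sub>R grad F w \<in> J}" using s by simp
  ultimately obtain \<epsilon> where \<epsilon>: "\<epsilon> > 0" "cball 0 \<epsilon> \<subseteq> {t::real. s + t *\<^sub>R grad F w \<in> J}"
    using open_contains_cball by blast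
  moreover have "\<epsilon> \<in> cball 0 \<epsilon>" using \<epsilon>(1) by (simp add: dist_real_def)
  ultimately have sJ: "s + \<epsilon> *\<^sub>R grad F w \<in> J" by blast
  define U where "U = (\<lambda>s'. s' + \<epsilon> *\<^sub>R grad F w) -` J"
  have "open U" unfolding U_def
    by (intro open_vimage continuous_on_add continuous_on_const continuous_on_id) simp
  then have ev: "\<forall>\<^sub>F s' in nhds s. s' \<in> U"
    using sJ by (intro eventually_nhds_in_open) (auto simp: U_def)
  define M where "M = - F w - \<nu> - \<nu> * ln \<epsilon>"
  have "dual_barrier K F s' \<le> M" if "s' \<in> U" for s'
    unfolding dual_barrier_def
  proof (rule cSUP_least[OF I_nonempty])
    fix x assume x: "x \<in> I"
    have "s' + \<epsilon> *\<^sub>R grad F w \<in> dual_cone K"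
      using that interior_subset unfolding U_def by blast
    then have "s' x + \<epsilon> * grad F w x \<ge> 0"
      using I_sub[OF x] by (auto simp: dual_cone_def blinfun.bilinear_simps)
    \<comment> \<open>The tangent of \<open>F\<close> at \<open>w\<close> is evaluated at
      \<open>\<epsilon> *\<^sub>R x\<close>; the summand \<nu> comes from
      \<open>grad F w w = - \<nu>\<close>.\<close>
    moreover have "F w + (\<epsilon> * grad F w x + \<nu>) \<le> F x - \<nu> * ln \<epsilon>"
      using F_tangent[OF w I_scaleR[OF x \<epsilon>(1)]] F_scaleR[OF x \<epsilon>(1)] grad_F_self[OF w]
      by (simp add: blinfun.bilinear_simps)
    ultimately show "- s' x - F x \<le> M" unfolding M_def by linarith
  qed
  with ev show ?thesis by (blast intro: eventually_mono)
qed

lemma dual_barrier_A: "x \<in> I \<Longrightarrow> dual_barrier K F (A x) = F x - 2 * F w - \<nu>"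
  by (rule self_scaledD[OF w])

text \<open>The set \<open>A(int K)\<close> is open in \<open>int K\<^sup>*\<close>. It is also closed there: the local bound on the dual
  barrier bounds \<open>F\<close> along \<open>A\<^sup>-\<^sup>1s\<^sub>n\<close>, so the limit cannot lie on the boundary of \<open>K\<close>.\<close>

lemma Ai_mem_I:
  assumes s: "s \<in> J" shows "Ai s \<in> I"
proof -
  let ?T = "J \<inter> Ai -` I"
  have "open (Ai -` I)"
    by (rule open_vimage) (auto intro: linear_continuous_on blinfun.bounded_linear_right)
  then have "openin (top_of_set J) ?T" by (rule openin_open_Int)
  moreover have "?T = J \<inter> closure ?T"
  proof
    show "J \<inter> closure ?T \<subseteq> ?T"
    proof
      fix u assume "u \<in> J \<inter> closure ?T"
      then obtain X where u: "u \<in> J" and X: "\<And>n. X n \<in> ?T" "X \<longlonglongrightarrow> u"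
        by (auto simp: closure_sequential)
      obtain M where "\<forall>\<^sub>F s' in nhds u. dual_barrier K F s' \<le> M"
        using dual_barrier_locally_bounded[OF u] by blast
      then have "\<forall>\<^sub>F n in sequentially. dual_barrier K F (X n) \<le> M"
        using X(2) by (rule eventually_compose_filterlim)
      then obtain N where N: "\<And>n. n \<ge> N \<Longrightarrow> dual_barrier K F (X n) \<le> M"
        by (auto simp: eventually_sequentially)
      have lim: "(\<lambda>n. Ai (X (n + N))) \<longlonglongrightarrow> Ai u"
        by (intro tendsto_intros LIMSEQ_ignore_initial_segment X)
      have mem: "Ai (X (n + N)) \<in> I" for n using X(1)[of "n + N"] by simp
      have "F (Ai (X (n + N))) \<le> M + 2 * F w + \<nu>" for n
        using N[of "n + N"] dual_barrier_A[OF mem[of n]] by (simp add: A_Ai)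
      from F_bounded_limit[OF mem this lim] u show "u \<in> ?T" by simp
    qed
  qed (use closure_subset[of ?T] in blast)
  then have "closedin (top_of_set J) ?T"
    by (metis closedin_closed closed_closure)
  moreover have "A w \<in> ?T" using A_mem_J[OF w] w by (simp add: Ai_A)
  ultimately have "?T = J"
    using convex_connected[OF J_convex] unfolding connected_clopen by blast
  then show ?thesis using s by blast
qed

lemma Ai_mem_I_iff: "Ai s \<in> I \<longleftrightarrow> s \<in> J"
  using Ai_mem_I A_mem_J[of "Ai s"] by (auto simp: A_Ai)

text \<open>Adding small multiples of \<open>A w\<close>, which is interior, moves \<open>s\<close>
  into \<open>J\<close>; the limit stays in the closed cone. Inequalities in the dual order thereby
  become inequalities in the order of \<open>K\<close>.\<close>

lemma Ai_mem_K:
  assumes s: "s \<in> dual_cone K" shows "Ai s \<in> K"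
proof -
  define X where "X n = Ai s + inverse (real (Suc n)) *\<^sub>R w" for n
  have "X n \<in> K" for n
  proof -
    have "inverse (real (Suc n)) *\<^sub>R A w + s \<in> J"
      by (intro interior_convex_cone_add[OF convex_cone_dual_cone _ s]
          interior_convex_cone_scaleR[OF convex_cone_dual_cone] A_mem_J[OF w]) simp
    from I_sub[OF Ai_mem_I[OF this]] show ?thesis
      by (simp add: X_def blinfun.bilinear_simps Ai_A add.commute)
  qed
  moreover have "X \<longlonglongrightarrow> Ai s + 0 *\<^sub>R w"
    unfolding X_def by (intro tendsto_intros LIMSEQ_inverse_real_of_nat)
  ultimately show ?thesis using closed_sequentially[OF K_closed, of X "Ai s"] by simp
qed

lemma dual_barrier_eq: "s \<in> J \<Longrightarrow> dual_barrier K F s = F (Ai s) + (- 2 * F w - \<nu>)"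
  using dual_barrier_A[OF Ai_mem_I, of s] by (simp add: A_Ai)

text \<open>The chain rule gives the functional \<open>t \<mapsto> grad F (Ai s) (Ai t)\<close>, and
  the symmetry of \<open>Ai\<close> shows which vector represents it.\<close>

lemma dual_grad_eq:
  assumes s: "s \<in> J"
  shows "dual_grad (dual_barrier K F) s = Ai (grad F (Ai s))"
proof -
  have "((\<lambda>s. F (Ai s)) has_derivative blinfun_apply (grad F (Ai s) o\<^sub>L Ai)) (at s)"
    by (rule has_derivative_compose_blinfun[OF bounded_linear_imp_has_derivative
          C1_map_has_derivative[OF F_C1 open_interior Ai_mem_I[OF s]]])
      (rule blinfun.bounded_linear_right)
  then have "((\<lambda>s. F (Ai s) + (- 2 * F w - \<nu>)) has_derivative blinfun_apply (grad F (Ai s) o\<^sub>L Ai)) (at s)"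
    using has_derivative_add[OF _ has_derivative_const[of "- 2 * F w - \<nu>"]] by simp
  then have "(dual_barrier K F has_derivative blinfun_apply (grad F (Ai s) o\<^sub>L Ai)) (at s)"
    by (rule has_derivative_transform_within_open[OF _ open_interior s]) (simp add: dual_barrier_eq)
  then have g: "grad (dual_barrier K F) s = grad F (Ai s) o\<^sub>L Ai" by (rule fderiv_eqI)
  show ?thesis
  proof (rule euclidean_eqI)
    fix b :: 'a assume "b \<in> Basis"
    have "blinfun_apply t (dual_grad (dual_barrier K F) s) = t (Ai (grad F (Ai s)))"
      for t :: "'a \<Rightarrow>\<^sub>L real"
      unfolding dual_grad_apply g by (simp add: Ai_sym)
    from this[of "blinfun_inner_right b"]
    show "dual_grad (dual_barrier K F) s \<bullet> b = Ai (grad F (Ai s)) \<bullet> b"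
      by (simp add: inner_commute)
  qed
qed

lemma Ai_grad_F_nonpos: "x \<in> I \<Longrightarrow> - Ai (grad F x) \<in> K"
  using Ai_mem_K[of "- grad F x"] grad_F_nonpos[of x]
  by (auto simp: dual_cone_def blinfun.bilinear_simps)

end

section \<open>The barrier of the hyperbolic coupling\<close>

locale compatible_self_scaled = self_scaled_point +
  assumes D4_le: "\<And>x h \<alpha> \<beta>. x \<in> interior K \<Longrightarrow>
      dual_cone_le K
        (D4 F x h (\<alpha> *\<^sub>R x + \<beta> *\<^sub>R h) (\<alpha> *\<^sub>R x + \<beta> *\<^sub>R h))
        ((- 3 * local_norm F x h) *\<^sub>R D3 F x (\<alpha> *\<^sub>R x + \<beta> *\<^sub>R h) (\<alpha> *\<^sub>R x + \<beta> *\<^sub>R h))"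
begin

text \<open>Adding the hypothesis for \<open>h\<close> and for \<open>-h\<close> cancels the fourth derivative.\<close>

lemma D3_F_nonpos:
  assumes x: "x \<in> I" shows "- D3 F x h h \<in> dual_cone K"
proof (cases "h = 0")
  case True
  then show ?thesis by (simp add: blinfun.bilinear_simps dual_cone_def)
next
  case False
  let ?n = "local_norm F x h"
  have n: "?n > 0" unfolding local_norm_def using hess_F_pos[OF x False] by simp
  have "dual_cone_le K (D4 F x h h h) ((- 3 * ?n) *\<^sub>R D3 F x h h)"
    using D4_le[OF x, of h 0 1] by simp
  moreover have "dual_cone_le K (- D4 F x h h h) ((- 3 * ?n) *\<^sub>R D3 F x h h)"
    using D4_le[OF x, of "- h" 0 "-1"] by (simp add: blinfun.bilinear_simps local_norm_def)
  ultimately have "((- 3 * ?n) *\<^sub>R D3 F x h h - D4 F x h h h) + ((- 3 * ?n) *\<^sub>R D3 F x h h - - D4 F x h h h)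
      \<in> dual_cone K"
    unfolding dual_cone_le_def by (rule convex_cone_add[OF convex_cone_dual_cone])
  then have "(6 * ?n) *\<^sub>R (- D3 F x h h) \<in> dual_cone K"
    by (simp add: algebra_simps flip: scaleR_add_left)
  from convex_cone_scaleR[OF convex_cone_dual_cone _ this, of "1 / (6 * ?n)"] n
  show ?thesis by simp
qed

section \<open>The domain of the coupling barrier\<close>

text \<open>For dual components in \<open>J\<close> this is the argument of \<open>F\<close> in the
  coupling barrier, by \<open>dual_grad_eq\<close>, expressed through \<open>F\<close>
  alone.\<close>

definition Y :: "'a \<times> ('a \<Rightarrow>\<^sub>L real) \<times> real \<Rightarrow> 'a"
  where "Y p = fst p + (snd (snd p))\<^sup>2 *\<^sub>R Ai (grad F (Ai (fst (snd p))))"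

definition Dom :: "('a \<times> ('a \<Rightarrow>\<^sub>L real) \<times> real) set"
  where "Dom = {p. fst (snd p) \<in> J \<and> Y p \<in> I}"

text \<open>\<open>Y\<close> contains \<open>grad F\<close>, so three derivatives of
  \<open>Y\<close> draw on four of \<open>F\<close>.\<close>

lemma Y_C3:
  assumes S: "open S" and SJ: "\<And>p. p \<in> S \<Longrightarrow> fst (snd p) \<in> J"
  shows "C3_map S Y"
proof -
  have lin: "bounded_linear (\<lambda>p::'a \<times> ('a \<Rightarrow>\<^sub>L real) \<times> real. snd (snd p))"
    "bounded_linear (\<lambda>p::'a \<times> ('a \<Rightarrow>\<^sub>L real) \<times> real. Ai (fst (snd p)))"
    by (intro bounded_linear_compose[OF bounded_linear_snd bounded_linear_snd]
        bounded_linear_compose[OF blinfun.bounded_linear_right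
          bounded_linear_compose[OF bounded_linear_fst bounded_linear_snd]])+
  note v = C3_map_bounded_linear[OF S lin(1)] and z = C3_map_bounded_linear[OF S lin(2)]
  have "C3_map S (\<lambda>p. grad F (Ai (fst (snd p))))"
    by (rule C3_map_compose[OF S open_interior z grad_F_C3]) (simp add: SJ Ai_mem_I)
  then have "C3_map S (\<lambda>p. Ai (grad F (Ai (fst (snd p)))))"
    by (rule C3_map_linear[OF S blinfun.bounded_linear_right])
  then have "C3_map S (\<lambda>p. (snd (snd p) * snd (snd p)) *\<^sub>R Ai (grad F (Ai (fst (snd p)))))"
    by (rule C3_map_bilinear[OF S bounded_bilinear_scaleR
          C3_map_bilinear[OF S bounded_bilinear_mult v v]])
  then show ?thesis unfolding Y_def[abs_def] power2_eq_square
    by (rule C3_map_add[OF S C3_map_bounded_linear[OF S bounded_linear_fst]])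
qed

lemma open_dual_slab: "open {p::'a \<times> ('a \<Rightarrow>\<^sub>L real) \<times> real. fst (snd p) \<in> J}"
proof -
  have "open (UNIV \<times> J \<times> (UNIV :: real set) :: ('a \<times> ('a \<Rightarrow>\<^sub>L real) \<times> real) set)"
    by (intro open_Times open_UNIV open_interior)
  moreover have "UNIV \<times> J \<times> UNIV = {p::'a \<times> ('a \<Rightarrow>\<^sub>L real) \<times> real. fst (snd p) \<in> J}" by auto
  ultimately show ?thesis by simp
qed

lemma Y_continuous: "continuous_on {p. fst (snd p) \<in> J} Y"
  using Y_C3[OF open_dual_slab]
  by (simp add: C1_map_continuous C2_map_imp_C1_map C3_map_imp_C2_map)

lemma open_Dom: "open Dom"
  using continuous_open_preimage[OF Y_continuous open_dual_slab open_interior, of K]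
  by (simp add: Dom_def vimage_def Collect_conj_eq)

text \<open>The term added to \<open>fst p\<close> in \<open>Y p\<close> is a nonnegative multiple
  of an element of \<open>- K\<close>. Hence \<open>fst p\<close> inherits membership in the cone
  from \<open>Y p\<close>, and later \<open>F (Y p)\<close> gets a lower bound in terms of
  \<open>fst p\<close>.\<close>

lemma Y_le:
  assumes "fst (snd p) \<in> J" shows "fst p - Y p \<in> K"
  using convex_cone_scaleR[OF K_cone zero_le_power2 Ai_grad_F_nonpos[OF Ai_mem_I[OF assms]],
      of "snd (snd p)"]
  by (simp add: Y_def)

lemma interior_hyperbolic_coupling: "interior (hyperbolic_coupling K F) = Dom"
proof
  show "Dom \<subseteq> interior (hyperbolic_coupling K F)"
  proof (rule interior_maximal[OF _ open_Dom], rule subsetI)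
    fix p assume "p \<in> Dom"
    then have p: "fst (snd p) \<in> J" "Y p \<in> I" by (auto simp: Dom_def)
    have "Y p + (fst p - Y p) \<in> K"
      by (rule I_sub[OF I_add[OF p(2) Y_le[OF p(1)]]])
    then have "fst p \<in> K" by simp
    then show "p \<in> hyperbolic_coupling K F"
      using p I_sub[OF p(2)] interior_subset[of "dual_cone K"]
      by (cases p) (auto simp: hyperbolic_coupling_def Y_def dual_grad_eq)
  qed
  show "interior (hyperbolic_coupling K F) \<subseteq> Dom"
  proof
    fix p assume p: "p \<in> interior (hyperbolic_coupling K F)"
    obtain x s v where [simp]: "p = (x, s, v)" by (cases p) auto
    have s: "s \<in> J" using interior_hyperbolic_coupling_subset p by fastforce
    define c where "c = v\<^sup>2 *\<^sub>R Ai (grad F (Ai s))"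
    \<comment> \<open>With \<open>s\<close> and \<open>v\<close> frozen, the third condition of the
      coupling at \<open>y - c\<close> says that \<open>y \<in> K\<close>. The slice of the
      interior, translated by \<open>c\<close>, is thus an open subset of \<open>K\<close>.\<close>
    let ?U = "(\<lambda>y. (y - c, s, v)) -` interior (hyperbolic_coupling K F)"
    have "open ?U"
      by (rule open_vimage[OF open_interior])
        (intro continuous_on_Pair continuous_on_diff continuous_on_const continuous_on_id)
    moreover have "x + c \<in> ?U" using p by simp
    moreover have "?U \<subseteq> K"
    proof
      fix y assume "y \<in> ?U"
      then have "(y - c, s, v) \<in> hyperbolic_coupling K F" using interior_subset by blast
      then show "y \<in> K" using s by (simp add: hyperbolic_coupling_def dual_grad_eq c_def)
    qed
    ultimately have "x + c \<in> I" by (rule interiorI)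
    then show "p \<in> Dom" using s by (simp add: Dom_def Y_def c_def)
  qed
qed

section \<open>The function \<Phi> and its derivatives along lines\<close>

definition \<Phi> :: "'a \<times> ('a \<Rightarrow>\<^sub>L real) \<times> real \<Rightarrow> real"
  where "\<Phi> = coupling_barrier K F"

lemma \<Phi>_eq:
  assumes "p \<in> Dom"
  shows "\<Phi> p = F (Y p) + (F (Ai (fst (snd p))) + (- 2 * F w - \<nu>))"
  using assms
  by (cases p) (simp add: \<Phi>_def coupling_barrier_def Dom_def Y_def dual_grad_eq dual_barrier_eq)

lemma \<Phi>_C3: "C3_map Dom \<Phi>"
proof (rule C3_map_cong[OF open_Dom _ \<Phi>_eq])
  have lin: "bounded_linear (\<lambda>p::'a \<times> ('a \<Rightarrow>\<^sub>L real) \<times> real. Ai (fst (snd p)))"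
    by (intro bounded_linear_compose[OF blinfun.bounded_linear_right
          bounded_linear_compose[OF bounded_linear_fst bounded_linear_snd]])
  have Y: "C3_map Dom Y" by (rule Y_C3[OF open_Dom]) (simp add: Dom_def)
  show "C3_map Dom (\<lambda>p. F (Y p) + (F (Ai (fst (snd p))) + (- 2 * F w - \<nu>)))"
    by (intro C3_map_add[OF open_Dom] C3_map_const[OF open_Dom]
        C3_map_compose[OF open_Dom open_interior Y F_C3]
        C3_map_compose[OF open_Dom open_interior C3_map_bounded_linear[OF open_Dom lin] F_C3])
      (simp_all add: Dom_def Ai_mem_I)
qed

text \<open>The derivatives of \<open>Y\<close> along the line through \<open>(x, As, v)\<close> with direction \<open>(h, A\<zeta>, r)\<close>, where \<open>s\<close>
  and \<open>\<zeta>\<close> are the preimages under \<open>A\<close>. Since \<open>v + tr\<close> times \<open>\<zeta>\<close> minus \<open>r\<close> times \<open>s + t\<zeta>\<close> does not depend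
  on \<open>t\<close>, the second derivative is \<open>D\<^sup>3F\<close> applied to a constant vector, and its derivative is immediate.\<close>

definition Y1 :: "'a \<Rightarrow> 'a \<Rightarrow> real \<Rightarrow> 'a \<Rightarrow> real \<Rightarrow> real \<Rightarrow> 'a"
  where "Y1 s h v \<zeta> r t = h + (2 * r * (v + t * r)) *\<^sub>R Ai (grad F (s + t *\<^sub>R \<zeta>))
    + (v + t * r)\<^sup>2 *\<^sub>R Ai (hess F (s + t *\<^sub>R \<zeta>) \<zeta>)"

definition Y2 :: "'a \<Rightarrow> real \<Rightarrow> 'a \<Rightarrow> real \<Rightarrow> real \<Rightarrow> 'a"
  where "Y2 s v \<zeta> r t = Ai (D3 F (s + t *\<^sub>R \<zeta>) (v *\<^sub>R \<zeta> - r *\<^sub>R s) (v *\<^sub>R \<zeta> - r *\<^sub>R s))"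

definition Y3 :: "'a \<Rightarrow> real \<Rightarrow> 'a \<Rightarrow> real \<Rightarrow> real \<Rightarrow> 'a"
  where "Y3 s v \<zeta> r t = Ai (D4 F (s + t *\<^sub>R \<zeta>) \<zeta> (v *\<^sub>R \<zeta> - r *\<^sub>R s) (v *\<^sub>R \<zeta> - r *\<^sub>R s))"

lemma Y_line:
  "Y ((x, s, v) + t *\<^sub>R (h, \<sigma>, r)) = x + t *\<^sub>R h + (v + t * r)\<^sup>2 *\<^sub>R Ai (grad F (Ai s + t *\<^sub>R Ai \<sigma>))"
  by (simp add: Y_def blinfun.bilinear_simps)

lemma Y_line_derivative:
  assumes st: "s + t *\<^sub>R \<zeta> \<in> I"
  shows "((\<lambda>t. x + t *\<^sub>R h + (v + t * r)\<^sup>2 *\<^sub>R Ai (grad F (s + t *\<^sub>R \<zeta>)))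
    has_vector_derivative Y1 s h v \<zeta> r t) (at t)"
proof -
  have g: "((\<lambda>t. Ai (grad F (s + t *\<^sub>R \<zeta>))) has_vector_derivative Ai (hess F (s + t *\<^sub>R \<zeta>) \<zeta>)) (at t)"
    by (rule bounded_linear.has_vector_derivative[OF blinfun.bounded_linear_right
          C1_map_line_derivative[OF open_interior grad_F_C1 st]])
  have v: "((\<lambda>t. (v + t * r)\<^sup>2) has_real_derivative 2 * r * (v + t * r)) (at t)"
    by (auto intro!: derivative_eq_intros)
  have l: "((\<lambda>t. x + t *\<^sub>R h) has_vector_derivative h) (at t)"
    by (auto intro!: derivative_eq_intros)
  show ?thesis
    using has_vector_derivative_add[OF l has_vector_derivative_scaleR[OF v g]]
    by (simp add: Y1_def algebra_simps)
qed

text \<open>Bilinear expansion: symmetry merges the mixed terms, and the Euler identities lower the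
  order wherever a slot contains \<open>z\<close>.\<close>

lemma D3_F_direction:
  assumes z: "z \<in> I"
  shows "D3 F z (v *\<^sub>R \<zeta> - r *\<^sub>R z) (v *\<^sub>R \<zeta> - r *\<^sub>R z)
    = (2 * r\<^sup>2) *\<^sub>R grad F z + (4 * r * v) *\<^sub>R hess F z \<zeta> + v\<^sup>2 *\<^sub>R D3 F z \<zeta> \<zeta>"
proof (rule blinfun_eqI)
  fix k
  show "D3 F z (v *\<^sub>R \<zeta> - r *\<^sub>R z) (v *\<^sub>R \<zeta> - r *\<^sub>R z) k = blinfun_apply
    ((2 * r\<^sup>2) *\<^sub>R grad F z + (4 * r * v) *\<^sub>R hess F z \<zeta> + v\<^sup>2 *\<^sub>R D3 F z \<zeta> \<zeta>) k"
    using D3_F_sym[OF z, of \<zeta> z]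
    by (simp add: blinfun.bilinear_simps D3_F_self[OF z] hess_F_self[OF z] power2_eq_square
        algebra_simps)
qed

lemma Y1_line_derivative:
  assumes st: "s + t *\<^sub>R \<zeta> \<in> I"
  shows "(Y1 s h v \<zeta> r has_vector_derivative Y2 s v \<zeta> r t) (at t)"
proof -
  let ?z = "s + t *\<^sub>R \<zeta>"
  have g: "((\<lambda>t. Ai (grad F (s + t *\<^sub>R \<zeta>))) has_vector_derivative Ai (hess F ?z \<zeta>)) (at t)"
    by (rule bounded_linear.has_vector_derivative[OF blinfun.bounded_linear_right
          C1_map_line_derivative[OF open_interior grad_F_C1 st]])
  have H: "((\<lambda>t. Ai (hess F (s + t *\<^sub>R \<zeta>) \<zeta>)) has_vector_derivative Ai (D3 F ?z \<zeta> \<zeta>)) (at t)"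
    by (rule bounded_linear.has_vector_derivative[OF blinfun.bounded_linear_right
          bounded_linear.has_vector_derivative[OF blinfun.bounded_linear_left
          C1_map_line_derivative[OF open_interior hess_F_C1 st]]])
  have v: "((\<lambda>t. (v + t * r)\<^sup>2) has_real_derivative 2 * r * (v + t * r)) (at t)"
    by (auto intro!: derivative_eq_intros)
  have v2: "((\<lambda>t. 2 * r * (v + t * r)) has_real_derivative 2 * r * r) (at t)"
    by (auto intro!: derivative_eq_intros)
  have "((\<lambda>t. h + (2 * r * (v + t * r)) *\<^sub>R Ai (grad F (s + t *\<^sub>R \<zeta>))
      + (v + t * r)\<^sup>2 *\<^sub>R Ai (hess F (s + t *\<^sub>R \<zeta>) \<zeta>)) has_vector_derivative
      0 + ((2 * r * (v + t * r)) *\<^sub>R Ai (hess F ?z \<zeta>) + (2 * r * r) *\<^sub>R Ai (grad F ?z))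
      + ((v + t * r)\<^sup>2 *\<^sub>R Ai (D3 F ?z \<zeta> \<zeta>) + (2 * r * (v + t * r)) *\<^sub>R Ai (hess F ?z \<zeta>))) (at t)"
    by (intro has_vector_derivative_add has_vector_derivative_const
        has_vector_derivative_scaleR v v2 g H)
  moreover have "Y2 s v \<zeta> r t = 0 + ((2 * r * (v + t * r)) *\<^sub>R Ai (hess F ?z \<zeta>) + (2 * r * r) *\<^sub>R Ai (grad F ?z))
      + ((v + t * r)\<^sup>2 *\<^sub>R Ai (D3 F ?z \<zeta> \<zeta>) + (2 * r * (v + t * r)) *\<^sub>R Ai (hess F ?z \<zeta>))"
  proof -
    \<comment> \<open>The constant vector has the shape required by \<open>D3_F_direction\<close> at
      the moving point \<open>?z\<close>, with \<open>v + t * r\<close> in place of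
      \<open>v\<close>.\<close>
    have q: "v *\<^sub>R \<zeta> - r *\<^sub>R s = (v + t * r) *\<^sub>R \<zeta> - r *\<^sub>R ?z" by (simp add: algebra_simps)
    have "(4 * r * (v + t * r)) *\<^sub>R Ai (hess F ?z \<zeta>)
        = (2 * r * (v + t * r)) *\<^sub>R Ai (hess F ?z \<zeta>) + (2 * r * (v + t * r)) *\<^sub>R Ai (hess F ?z \<zeta>)"
      unfolding scaleR_add_left[symmetric] by simp
    then show ?thesis
      unfolding Y2_def q D3_F_direction[OF st]
      by (simp add: blinfun.add_right blinfun.scaleR_right power2_eq_square mult.assoc)
  qed
  ultimately show ?thesis by (simp add: Y1_def[abs_def])
qed

lemma Y2_line_derivative:
  assumes st: "s + t *\<^sub>R \<zeta> \<in> I"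
  shows "(Y2 s v \<zeta> r has_vector_derivative Y3 s v \<zeta> r t) (at t)"
  unfolding Y2_def[abs_def] Y3_def
  by (rule bounded_linear.has_vector_derivative[OF blinfun.bounded_linear_right
        bounded_linear.has_vector_derivative[OF blinfun.bounded_linear_left
          bounded_linear.has_vector_derivative[OF blinfun.bounded_linear_left
            C1_map_line_derivative[OF open_interior D3_F_C1 st]]]])

lemma Y2_nonpos: "s + t *\<^sub>R \<zeta> \<in> I \<Longrightarrow> - Y2 s v \<zeta> r t \<in> K"
  using Ai_mem_K[OF D3_F_nonpos, of "s + t *\<^sub>R \<zeta>"]
  by (simp add: Y2_def blinfun.minus_right)

text \<open>The hypothesis bounds the fourth derivative from above, so it is used at
  \<open>- \<zeta>\<close> to give a lower bound; the coefficients \<open>- r\<close> and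
  \<open>- v\<close> then reproduce, up to the notation \<open>q\<close>, the same vector. The
  parameter 0 makes the base point in \<open>q\<close> the point of evaluation.\<close>

lemma Y3_ge:
  assumes z: "z \<in> I"
  shows "Y3 z v \<zeta> r 0 - (3 * local_norm F z \<zeta>) *\<^sub>R Y2 z v \<zeta> r 0 \<in> K"
proof -
  define q where "q = v *\<^sub>R \<zeta> - r *\<^sub>R z"
  have q: "(- r) *\<^sub>R z + (- v) *\<^sub>R (- \<zeta>) = q" by (simp add: q_def)
  have n: "local_norm F z (- \<zeta>) = local_norm F z \<zeta>"
    by (simp add: local_norm_def blinfun.bilinear_simps)
  have "(- 3 * local_norm F z \<zeta>) *\<^sub>R D3 F z q q - D4 F z (- \<zeta>) q q \<in> dual_cone K"
    using D4_le[OF z, of "- \<zeta>" "- r" "- v"] unfolding dual_cone_le_def q n .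
  from Ai_mem_K[OF this] show ?thesis
    unfolding Y2_def Y3_def q_def[symmetric] by (simp add: blinfun.bilinear_simps)
qed

lemma Dom_line: "(x, s, v) + t *\<^sub>R (h, \<sigma>, r) \<in> Dom \<longleftrightarrow> Ai s + t *\<^sub>R Ai \<sigma> \<in> I \<and>
    x + t *\<^sub>R h + (v + t * r)\<^sup>2 *\<^sub>R Ai (grad F (Ai s + t *\<^sub>R Ai \<sigma>)) \<in> I"
proof -
  have "s + t *\<^sub>R \<sigma> \<in> J \<longleftrightarrow> Ai s + t *\<^sub>R Ai \<sigma> \<in> I"
    using Ai_mem_I_iff[of "s + t *\<^sub>R \<sigma>"] by (simp add: blinfun.bilinear_simps)
  then show ?thesis unfolding Dom_def mem_Collect_eq Y_line by simp
qed

lemma \<Phi>_derivatives: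
  fixes x h :: 'a and s \<sigma> :: "'a \<Rightarrow>\<^sub>L real" and v r :: real
  assumes p: "(x, s, v) \<in> Dom"
  defines "z \<equiv> Ai s" and "\<zeta> \<equiv> Ai \<sigma>" and "y \<equiv> Y (x, s, v)"
  defines "y1 \<equiv> Y1 (Ai s) h v (Ai \<sigma>) r 0" and "y2 \<equiv> Y2 (Ai s) v (Ai \<sigma>) r 0"
    and "y3 \<equiv> Y3 (Ai s) v (Ai \<sigma>) r 0"
  shows "grad \<Phi> (x, s, v) (h, \<sigma>, r) = grad F y y1 + grad F z \<zeta>"
    and "hess \<Phi> (x, s, v) (h, \<sigma>, r) (h, \<sigma>, r) = hess F y y1 y1 + grad F y y2 + hess F z \<zeta> \<zeta>"
    and "D3 \<Phi> (x, s, v) (h, \<sigma>, r) (h, \<sigma>, r) (h, \<sigma>, r)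
      = D3 F y y1 y1 y1 + 3 * hess F y y1 y2 + grad F y y3 + D3 F z \<zeta> \<zeta> \<zeta>"
proof -
  let ?z = "\<lambda>t. Ai s + t *\<^sub>R Ai \<sigma>"
  define b where "b t = x + t *\<^sub>R h + (v + t * r)\<^sup>2 *\<^sub>R Ai (grad F (?z t))" for t
  let ?b1 = "Y1 (Ai s) h v (Ai \<sigma>) r" and ?b2 = "Y2 (Ai s) v (Ai \<sigma>) r" and ?b3 = "Y3 (Ai s) v (Ai \<sigma>) r"
  define \<phi> where "\<phi> t = F (b t) + (F (?z t) + (- 2 * F w - \<nu>))" for t
  define \<phi>1 where "\<phi>1 t = grad F (b t) (?b1 t) + grad F (?z t) (Ai \<sigma>)" for t
  define \<phi>2 where "\<phi>2 t = hess F (b t) (?b1 t) (?b1 t) + grad F (b t) (?b2 t)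
    + hess F (?z t) (Ai \<sigma>) (Ai \<sigma>)" for t
  define \<phi>3 where "\<phi>3 t = D3 F (b t) (?b1 t) (?b1 t) (?b1 t) + 3 * hess F (b t) (?b1 t) (?b2 t)
    + grad F (b t) (?b3 t) + D3 F (?z t) (Ai \<sigma>) (Ai \<sigma>) (Ai \<sigma>)" for t
  have mem: "?z t \<in> I" "b t \<in> I" if "(x, s, v) + t *\<^sub>R (h, \<sigma>, r) \<in> Dom" for t
    using that unfolding Dom_line b_def by auto
  have b': "(b has_vector_derivative ?b1 t) (at t)" if "?z t \<in> I" for t
    unfolding b_def[abs_def] by (rule Y_line_derivative[OF that])
  note line = line_derivatives_eqI[OF open_Dom \<Phi>_C3, where \<phi> = \<phi> and \<phi>' = \<phi>1 and \<phi>'' = \<phi>2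
      and \<phi>''' = \<phi>3 and t = 0 and p = "(x, s, v)" and d = "(h, \<sigma>, r)"]
  have eq: "\<Phi> ((x, s, v) + t *\<^sub>R (h, \<sigma>, r)) = \<phi> t" if "(x, s, v) + t *\<^sub>R (h, \<sigma>, r) \<in> Dom" for t
    unfolding \<Phi>_eq[OF that] Y_line \<phi>_def b_def by (simp add: blinfun.bilinear_simps)
  have d0: "(\<phi> has_real_derivative \<phi>1 t) (at t)" if t: "(x, s, v) + t *\<^sub>R (h, \<sigma>, r) \<in> Dom" for t
  proof -
    note m = mem[OF t]
    have "((\<lambda>t. F (b t)) has_real_derivative grad F (b t) (?b1 t)) (at t)"
      unfolding has_real_derivative_iff_has_vector_derivative
      by (rule C1_map_curve_derivative[OF open_interior F_C1 b'[OF m(1)] m(2)])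
    then show ?thesis
      unfolding \<phi>_def[abs_def] \<phi>1_def
      using C1_map_line_real_derivative[OF open_interior F_C1 m(1)]
      by (auto intro!: derivative_eq_intros)
  qed
  have d1: "(\<phi>1 has_real_derivative \<phi>2 t) (at t)" if t: "(x, s, v) + t *\<^sub>R (h, \<sigma>, r) \<in> Dom" for t
  proof -
    note m = mem[OF t]
    have "((\<lambda>t. grad F (b t) (?b1 t)) has_vector_derivative
        hess F (b t) (?b1 t) (?b1 t) + grad F (b t) (?b2 t)) (at t)"
      by (intro has_vector_derivative_blinfun_apply Y1_line_derivative[OF m(1)]
          C1_map_curve_derivative[OF open_interior grad_F_C1 b'[OF m(1)] m(2)])
    then show ?thesis
      unfolding \<phi>1_def[abs_def] \<phi>2_def
      using hess_line_derivative[OF open_interior F_C2 m(1), of "Ai \<sigma>"]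
      by (intro DERIV_add) (simp_all add: has_real_derivative_iff_has_vector_derivative)
  qed
  have d2: "(\<phi>2 has_real_derivative \<phi>3 t) (at t)" if t: "(x, s, v) + t *\<^sub>R (h, \<sigma>, r) \<in> Dom" for t
  proof -
    note m = mem[OF t]
    have h: "((\<lambda>t. hess F (b t) (?b1 t) (?b1 t)) has_vector_derivative
        (D3 F (b t) (?b1 t) (?b1 t) + hess F (b t) (?b2 t)) (?b1 t) + hess F (b t) (?b1 t) (?b2 t)) (at t)"
      by (intro has_vector_derivative_blinfun_apply Y1_line_derivative[OF m(1)]
          C1_map_curve_derivative[OF open_interior hess_F_C1 b'[OF m(1)] m(2)])
    have g: "((\<lambda>t. grad F (b t) (?b2 t)) has_vector_derivative
        hess F (b t) (?b1 t) (?b2 t) + grad F (b t) (?b3 t)) (at t)"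
      by (intro has_vector_derivative_blinfun_apply Y2_line_derivative[OF m(1)]
          C1_map_curve_derivative[OF open_interior grad_F_C1 b'[OF m(1)] m(2)])
    have D: "((\<lambda>t. hess F (?z t) (Ai \<sigma>) (Ai \<sigma>)) has_vector_derivative
        D3 F (?z t) (Ai \<sigma>) (Ai \<sigma>) (Ai \<sigma>)) (at t)"
      using D3_line_derivative[OF open_interior F_C3 m(1), of "Ai \<sigma>" "Ai \<sigma>"]
      by (simp add: has_real_derivative_iff_has_vector_derivative)
    \<comment> \<open>Two mixed terms come from the Hessian part and one from the gradient part;
      symmetry merges them into the factor 3.\<close>
    have "\<phi>3 t = (D3 F (b t) (?b1 t) (?b1 t) + hess F (b t) (?b2 t)) (?b1 t) + hess F (b t) (?b1 t) (?b2 t)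
        + (hess F (b t) (?b1 t) (?b2 t) + grad F (b t) (?b3 t)) + D3 F (?z t) (Ai \<sigma>) (Ai \<sigma>) (Ai \<sigma>)"
      unfolding \<phi>3_def using hess_F_sym[OF m(2), of "?b2 t" "?b1 t"] by (simp add: blinfun.add_left)
    then show ?thesis
      unfolding \<phi>2_def[abs_def] has_real_derivative_iff_has_vector_derivative
      using has_vector_derivative_add[OF has_vector_derivative_add[OF h g] D] by simp
  qed
  have p0: "(x, s, v) + 0 *\<^sub>R (h, \<sigma>, r) \<in> Dom" using p by simp
  have b0: "b 0 = Y (x, s, v)" by (simp add: b_def Y_def)
  note line = line[OF p0 eq d0 d1 d2]
  show "grad \<Phi> (x, s, v) (h, \<sigma>, r) = grad F y y1 + grad F z \<zeta>"
    using line(1) unfolding \<phi>1_def b0 y_def y1_def z_def \<zeta>_def by simp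
  show "hess \<Phi> (x, s, v) (h, \<sigma>, r) (h, \<sigma>, r) = hess F y y1 y1 + grad F y y2 + hess F z \<zeta> \<zeta>"
    using line(2) unfolding \<phi>2_def b0 y_def y1_def y2_def z_def \<zeta>_def by simp
  show "D3 \<Phi> (x, s, v) (h, \<sigma>, r) (h, \<sigma>, r) (h, \<sigma>, r)
      = D3 F y y1 y1 y1 + 3 * hess F y y1 y2 + grad F y y3 + D3 F z \<zeta> \<zeta> \<zeta>"
    using line(3) unfolding \<phi>3_def b0 y_def y1_def y2_def y3_def z_def \<zeta>_def by simp
qed

section \<open>The self-concordance and barrier inequalities\<close>

lemma \<Phi>_inequalities:
  assumes p: "p \<in> Dom"
  shows "hess \<Phi> p d d \<ge> 0"
    and "(grad \<Phi> p d)\<^sup>2 \<le> (2 * \<nu>) * hess \<Phi> p d d"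
    and "D3 \<Phi> p d d d \<le> 2 * (hess \<Phi> p d d) powr (3/2)"
proof -
  obtain x s v where px: "p = (x, s, v)" by (cases p) auto
  obtain h \<sigma> r where dx: "d = (h, \<sigma>, r)" by (cases d) auto
  define z \<zeta> y where "z = Ai s" and "\<zeta> = Ai \<sigma>" and "y = Y (x, s, v)"
  define y1 y2 y3 where "y1 = Y1 (Ai s) h v (Ai \<sigma>) r 0" and "y2 = Y2 (Ai s) v (Ai \<sigma>) r 0"
    and "y3 = Y3 (Ai s) v (Ai \<sigma>) r 0"
  have z: "z \<in> I" and y: "y \<in> I"
    using p Ai_mem_I by (auto simp: px Dom_def z_def y_def)
  note \<Phi>_derivatives[OF p[unfolded px], of h \<sigma> r, folded z_def \<zeta>_def y_def y1_def y2_def y3_def]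
  note der = this[folded px dx]
  define P where "P = sqrt (hess F y y1 y1)"
  define Q where "Q = grad F y y2"
  define R where "R = sqrt (hess F z \<zeta> \<zeta>)"
  have P: "P \<ge> 0" "P\<^sup>2 = hess F y y1 y1" and R: "R \<ge> 0" "R\<^sup>2 = hess F z \<zeta> \<zeta>"
    using hess_F_nonneg[OF y, of y1] hess_F_nonneg[OF z, of \<zeta>] by (simp_all add: P_def R_def)
  have y2K: "- y2 \<in> K"
    using Y2_nonpos[of "Ai s" 0 "Ai \<sigma>" v r] z by (simp add: y2_def z_def)
  \<comment> \<open>Since \<open>- y2 \<in> K\<close>, its local norm is bounded by a term that is
    linear in \<open>y2\<close>; this controls the mixed term below and shows
    \<open>Q \<ge> 0\<close>.\<close>
  have y2Q: "sqrt (hess F y y2 y2) \<le> Q"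
    using local_norm_le[OF y y2K] by (simp add: Q_def blinfun.bilinear_simps)
  then have Q: "Q \<ge> 0" using hess_F_nonneg[OF y, of y2] by (meson order_trans real_sqrt_ge_zero)
  have hess: "hess \<Phi> p d d = P\<^sup>2 + Q + R\<^sup>2" unfolding der(2) P R Q_def by simp
  show "hess \<Phi> p d d \<ge> 0" unfolding hess using Q by simp
  show "(grad \<Phi> p d)\<^sup>2 \<le> (2 * \<nu>) * hess \<Phi> p d d"
  proof -
    \<comment> \<open>The parameter doubles because the squared sum of the two gradient terms is at
      most twice the sum of their squares.\<close>
    define a b where "a = grad F y y1" and "b = grad F z \<zeta>"
    have "a\<^sup>2 \<le> \<nu> * P\<^sup>2" "b\<^sup>2 \<le> \<nu> * R\<^sup>2"
      unfolding a_def b_def P R by (rule F_grad_sq_le[OF y] F_grad_sq_le[OF z])+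
    moreover have "(a + b)\<^sup>2 \<le> 2 * a\<^sup>2 + 2 * b\<^sup>2"
      using zero_le_power2[of "a - b"] by (simp add: power2_eq_square algebra_simps)
    moreover have "0 \<le> \<nu> * Q" using Q nu_ge_1 by simp
    ultimately have "(a + b)\<^sup>2 \<le> 2 * (\<nu> * P\<^sup>2) + 2 * (\<nu> * Q) + 2 * (\<nu> * R\<^sup>2)" by linarith
    then show ?thesis unfolding der(1) hess a_def b_def by (simp add: algebra_simps)
  qed
  show "D3 \<Phi> p d d d \<le> 2 * (hess \<Phi> p d d) powr (3/2)"
  proof -
    have "D3 F y y1 y1 y1 \<le> 2 * P ^ 3" unfolding P_def by (rule F_D3_bounds[OF y])
    moreover have "D3 F z \<zeta> \<zeta> \<zeta> \<le> 2 * R ^ 3" unfolding R_def by (rule F_D3_bounds[OF z])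
    moreover have "hess F y y1 y2 \<le> P * Q"
    proof -
      have "\<bar>hess F y y1 y2\<bar> = sqrt ((hess F y y1 y2)\<^sup>2)" by simp
      also have "\<dots> \<le> sqrt (hess F y y1 y1 * hess F y y2 y2)"
        by (rule real_sqrt_le_mono[OF hess_F_cauchy_schwarz[OF y]])
      also have "\<dots> = P * sqrt (hess F y y2 y2)" by (simp add: P_def real_sqrt_mult)
      also have "\<dots> \<le> P * Q" by (rule mult_left_mono[OF y2Q P(1)])
      finally show ?thesis by simp
    qed
    \<comment> \<open>By compatibility \<open>y3\<close> exceeds \<open>3 * R\<close> times
      \<open>y2\<close> by an element of \<open>K\<close>, where the gradient at \<open>y\<close> is
      nonpositive.\<close>
    moreover have "grad F y y3 \<le> 3 * R * Q"
    proof -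
      have "y3 - (3 * R) *\<^sub>R y2 \<in> K"
        using Y3_ge[OF z, of v \<zeta> r] by (simp add: y2_def y3_def z_def \<zeta>_def R_def local_norm_def)
      from grad_F_nonpos[OF y this] show ?thesis by (simp add: Q_def blinfun.bilinear_simps)
    qed
    ultimately have "D3 \<Phi> p d d d \<le> 2 * P ^ 3 + 3 * P * Q + 3 * R * Q + 2 * R ^ 3"
      unfolding der(3) by linarith
    also have "\<dots> \<le> 2 * (P\<^sup>2 + Q + R\<^sup>2) powr (3/2)"
      by (rule compatibility_inequality[OF P(1) Q R(1)])
    finally show ?thesis unfolding hess .
  qed
qed

section \<open>Convexity of the domain and closedness of \<Phi>\<close>

text \<open>Concavity in the order of \<open>K\<close> is tested against dual functionals, which
  suffices by \<open>bipolar_cone\<close>. Along a segment each test has the sign given by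
  \<open>Y2_nonpos\<close>.\<close>

lemma Y_concave:
  assumes p: "fst (snd p) \<in> J" "fst (snd p') \<in> J" and t: "0 < t" "t < 1"
  shows "Y ((1 - t) *\<^sub>R p + t *\<^sub>R p') - ((1 - t) *\<^sub>R Y p + t *\<^sub>R Y p') \<in> K"
proof (rule bipolar_cone[OF K_closed K_cone])
  fix \<eta> assume \<eta>: "\<eta> \<in> dual_cone K"
  obtain x s v where px: "p = (x, s, v)" by (cases p) auto
  obtain h \<sigma> r where dx: "p' - p = (h, \<sigma>, r)" by (cases "p' - p") auto
  let ?z = "\<lambda>t::real. Ai s + t *\<^sub>R Ai \<sigma>"
  let ?T = "{t::real. ?z t \<in> I}"
  define b where "b t = x + t *\<^sub>R h + (v + t * r)\<^sup>2 *\<^sub>R Ai (grad F (?z t))" for t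
  let ?b1 = "Y1 (Ai s) h v (Ai \<sigma>) r" and ?b2 = "Y2 (Ai s) v (Ai \<sigma>) r"
  have Yb: "Y (p + t *\<^sub>R (p' - p)) = b t" for t unfolding px dx[unfolded px] Y_line b_def ..
  have conv: "convex ?T" by (rule convex_line_preimage[OF I_convex])
  have "convex_on ?T (\<lambda>t. - \<eta> (b t))"
  proof (rule f''_ge0_imp_convex[OF conv])
    fix t assume "t \<in> ?T"
    then have t: "?z t \<in> I" by simp
    have "((\<lambda>t. \<eta> (b t)) has_vector_derivative \<eta> (?b1 t)) (at t)"
      unfolding b_def[abs_def]
      by (rule bounded_linear.has_vector_derivative[OF blinfun.bounded_linear_right
            Y_line_derivative[OF t]])
    then show "((\<lambda>t. - \<eta> (b t)) has_real_derivative - \<eta> (?b1 t)) (at t)"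
      by (intro DERIV_minus) (simp add: has_real_derivative_iff_has_vector_derivative)
    have "((\<lambda>t. \<eta> (?b1 t)) has_vector_derivative \<eta> (?b2 t)) (at t)"
      by (rule bounded_linear.has_vector_derivative[OF blinfun.bounded_linear_right
            Y1_line_derivative[OF t]])
    then show "((\<lambda>t. - \<eta> (?b1 t)) has_real_derivative - \<eta> (?b2 t)) (at t)"
      by (intro DERIV_minus) (simp add: has_real_derivative_iff_has_vector_derivative)
    have "0 \<le> \<eta> (- ?b2 t)" using \<eta> Y2_nonpos[OF t] by (auto simp: dual_cone_def)
    then show "0 \<le> - \<eta> (?b2 t)" by (simp add: blinfun.bilinear_simps)
  qed
  moreover have "0 \<in> ?T" using p(1) Ai_mem_I by (simp add: px)
  moreover have "1 \<in> ?T"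
  proof -
    have "fst (snd p') = s + \<sigma>" using dx px by (cases p') auto
    then show ?thesis using p(2) Ai_mem_I[of "s + \<sigma>"] by (simp add: blinfun.bilinear_simps)
  qed
  ultimately have "- \<eta> (b ((1 - t) *\<^sub>R 0 + t *\<^sub>R 1)) \<le> (1 - t) * (- \<eta> (b 0)) + t * (- \<eta> (b 1))"
    using t by (intro convex_onD) auto
  then have le: "(1 - t) * \<eta> (b 0) + t * \<eta> (b 1) \<le> \<eta> (b t)" by simp
  have "b 0 = Y p" "b 1 = Y p'" "b t = Y ((1 - t) *\<^sub>R p + t *\<^sub>R p')"
    using Yb[of 0] Yb[of 1] Yb[of t] by (simp_all add: algebra_simps)
  with le show "0 \<le> \<eta> (Y ((1 - t) *\<^sub>R p + t *\<^sub>R p') - ((1 - t) *\<^sub>R Y p + t *\<^sub>R Y p'))"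
    by (simp add: blinfun.bilinear_simps)
qed

text \<open>At a convex combination \<open>Y\<close> is an interior point, the combination of the
  values, plus an element of \<open>K\<close>.\<close>

lemma convex_Dom: "convex Dom"
  unfolding convex_alt
proof (intro ballI allI impI, elim conjE)
  fix p p' and t :: real
  assume p: "p \<in> Dom" "p' \<in> Dom" and t: "0 \<le> t" "t \<le> 1"
  show "(1 - t) *\<^sub>R p + t *\<^sub>R p' \<in> Dom"
  proof (cases "t = 0 \<or> t = 1")
    case False
    then have t: "0 < t" "t < 1" using t by auto
    let ?q = "(1 - t) *\<^sub>R p + t *\<^sub>R p'"
    have "fst (snd ?q) \<in> J"
      using convexD_alt[OF J_convex, of "fst (snd p)" "fst (snd p')" t] p t by (simp add: Dom_def)
    moreover have "(1 - t) *\<^sub>R Y p + t *\<^sub>R Y p' \<in> I"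
      using convexD_alt[OF I_convex, of "Y p" "Y p'" t] p t by (simp add: Dom_def)
    from I_add[OF this Y_concave[OF _ _ t, of p p']] p have "Y ?q \<in> I" by (simp add: Dom_def)
    ultimately show ?thesis by (simp add: Dom_def)
  qed (use p in auto)
qed

text \<open>Along a convergent sequence with bounded values, \<open>F(Y)\<close> is bounded below because \<open>Y \<le> x\<close> in the
  order of \<open>K\<close>. Hence both summands of \<open>\<Phi>\<close> are bounded above.\<close>

lemma closed_epigraph_\<Phi>: "closed (epigraph Dom \<Phi>)"
  unfolding closed_sequential_limits
proof (intro allI impI, elim conjE)
  fix X l assume X: "\<forall>n. X n \<in> epigraph Dom \<Phi>" "X \<longlonglongrightarrow> l"
  define p where "p n = fst (X n)" for n
  define \<mu> where "\<mu> n = snd (X n)" for n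
  define z where "z n = Ai (fst (snd (p n)))" for n
  obtain p0 \<mu>0 where l: "l = (p0, \<mu>0)" by (cases l) auto
  define z0 where "z0 = Ai (fst (snd p0))"
  have p: "p \<longlonglongrightarrow> p0" and \<mu>: "\<mu> \<longlonglongrightarrow> \<mu>0"
    using tendsto_fst[OF X(2)] tendsto_snd[OF X(2)] unfolding p_def \<mu>_def l by simp_all
  have Dp: "p n \<in> Dom" and le: "\<Phi> (p n) \<le> \<mu> n" for n
    using X(1) by (auto simp: p_def \<mu>_def epigraph_def)
  have z: "z \<longlonglongrightarrow> z0" unfolding z_def z0_def by (intro tendsto_intros p)
  have zI: "z n \<in> I" and yI: "Y (p n) \<in> I" and sJ: "fst (snd (p n)) \<in> J" for n
    using Dp[of n] Ai_mem_I by (auto simp: Dom_def z_def)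
  have bound: "F (Y (p n)) + F (z n) \<le> \<mu> n + 2 * F w + \<nu>" for n
    using le[of n] \<Phi>_eq[OF Dp[of n]] by (simp add: z_def)
  \<comment> \<open>In the tangent at \<open>w\<close> the unknown \<open>Y (p n)\<close> is
    replaced by the convergent \<open>fst (p n)\<close>: their difference lies in \<open>K\<close>,
    where \<open>grad F w\<close> is nonpositive.\<close>
  have lower: "F w + grad F w (fst (p n) - w) \<le> F (Y (p n))" for n
  proof -
    have "grad F w (fst (p n) - Y (p n)) \<le> 0" by (rule grad_F_nonpos[OF w Y_le[OF sJ]])
    then show ?thesis using F_tangent[OF w yI[of n]] by (simp add: blinfun.bilinear_simps)
  qed
  have bdd: "\<exists>M. \<forall>n. a n \<le> M" if "a \<longlonglongrightarrow> c" for a :: "nat \<Rightarrow> real" and c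
    using Bseq_eq_bounded[of a] convergent_imp_Bseq[OF convergentI[OF that]]
    by (metis abs_le_D1 Bseq_def real_norm_def)
  obtain M where M: "\<And>n. \<mu> n + 2 * F w + \<nu> - (F w + grad F w (fst (p n) - w)) \<le> M"
    using bdd[OF tendsto_diff[OF tendsto_add[OF tendsto_add[OF \<mu> tendsto_const] tendsto_const]
          tendsto_add[OF tendsto_const blinfun.tendsto[OF tendsto_const
            tendsto_diff[OF tendsto_fst[OF p] tendsto_const]]]]] by blast
  have "F (z n) \<le> M" for n using M[of n] bound[of n] lower[of n] by linarith
  from F_bounded_limit[OF zI this z] have z0: "z0 \<in> I" .
  then have s0: "fst (snd p0) \<in> J" unfolding z0_def by (simp add: Ai_mem_I_iff)
  \<comment> \<open>Only now, with the limit of the dual components known to be in \<open>J\<close>,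
    is \<open>Y\<close> continuous at the limit; the convergence of \<open>F (z n)\<close> then
    bounds the other summand.\<close>
  have "isCont Y p0"
    using Y_continuous s0 unfolding continuous_on_eq_continuous_at[OF open_dual_slab] by blast
  then have Yl: "(\<lambda>n. Y (p n)) \<longlonglongrightarrow> Y p0" using p by (rule isCont_tendsto_compose)
  have "isCont F z0"
    using C1_map_continuous[OF F_C1] z0 by (simp add: continuous_on_eq_continuous_at)
  then have Fz: "(\<lambda>n. F (z n)) \<longlonglongrightarrow> F z0" using z by (rule isCont_tendsto_compose)
  obtain M' where M': "\<And>n. \<mu> n + 2 * F w + \<nu> - F (z n) \<le> M'"
    using bdd[OF tendsto_diff[OF tendsto_add[OF tendsto_add[OF \<mu> tendsto_const] tendsto_const] Fz]]
    by blast
  have "F (Y (p n)) \<le> M'" for n using M'[of n] bound[of n] by linarith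
  from F_bounded_limit[OF yI this Yl] s0 have D: "p0 \<in> Dom" by (simp add: Dom_def)
  have "isCont \<Phi> p0"
    using C1_map_continuous[OF C2_map_imp_C1_map[OF C3_map_imp_C2_map[OF \<Phi>_C3]]] D
    by (simp add: continuous_on_eq_continuous_at[OF open_Dom])
  then have "(\<lambda>n. \<Phi> (p n)) \<longlonglongrightarrow> \<Phi> p0" using p by (rule isCont_tendsto_compose)
  then have "\<Phi> p0 \<le> \<mu>0" using \<mu> le by (intro LIMSEQ_le) auto
  then show "l \<in> epigraph Dom \<Phi>" using D by (simp add: l mem_epigraph)
qed

lemma \<Phi>_self_concordant_barrier:
  "self_concordant_barrier_for (hyperbolic_coupling K F) (coupling_barrier K F) (2 * \<nu>)"
proof -
  have "convex_on Dom \<Phi>"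
    by (rule convex_on_hess_nonneg[OF open_Dom convex_Dom C3_map_imp_C2_map[OF \<Phi>_C3]
          \<Phi>_inequalities(1)])
  then have "self_concordant_barrier Dom \<Phi> (2 * \<nu>)"
    unfolding self_concordant_barrier_def self_concordant_def C3_on_iff_C3_map
    using open_Dom closed_epigraph_\<Phi> \<Phi>_C3 \<Phi>_inequalities nu_ge_1 by auto
  then show ?thesis
    by (simp add: self_concordant_barrier_for_def interior_hyperbolic_coupling \<Phi>_def)
qed

end

theorem theorem4p7:
  fixes K :: "'a::euclidean_space set" and F :: "'a \<Rightarrow> real" and \<nu> :: real
  assumes "symmetric_cone K"
    and "self_scaled_barrier K \<nu> F"
    and "C4_on (interior K) F"
    and "\<And>x h \<alpha> \<beta>. x \<in> interior K \<Longrightarrow>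
      dual_cone_le K
        (D4 F x h (\<alpha> *\<^sub>R x + \<beta> *\<^sub>R h) (\<alpha> *\<^sub>R x + \<beta> *\<^sub>R h))
        ((- 3 * local_norm F x h) *\<^sub>R D3 F x (\<alpha> *\<^sub>R x + \<beta> *\<^sub>R h) (\<alpha> *\<^sub>R x + \<beta> *\<^sub>R h))"
  shows "self_concordant_barrier_for (hyperbolic_coupling K F) (coupling_barrier K F) (2 * \<nu>)"
proof -
  have proper: "proper_cone K" using assms(1) by (simp add: symmetric_cone_def)
  \<comment> \<open>Any interior point serves as scaling point, since the conclusion does not
    mention it.\<close>
  then obtain w where "w \<in> interior K" by (auto simp: proper_cone_def)
  with proper interpret compatible_self_scaled K F \<nu> w
    by unfold_locales (use assms(2-4) in auto)
  show ?thesis by (rule \<Phi>_self_concordant_barrier)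
qed

end
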